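(* Let $\Omega\subset\mathbb{R}^N$ be an open and bounded set, $A:\mathbb{R}^N\to\mathbb{R}^N$ a (measurable) locally bounded function and $u\in BV_A(\Omega)$. There exists a unique $\mathbb{R}^{2N}$-valued finite Radon measure $\mu_{A,u}=(\mu_{1,A,u},\mu_{2,A,u})$ on $\Omega$ such that $$\int_\Omega u(x)\,\mathrm{div}\,\varphi(x)+\mathrm{i}A(x)\cdot\varphi(x)\,u(x)\,dx=\int_\Omega\Re u\,\mathrm{div}\,\varphi-A\cdot\varphi\,\Im u\,dx+\mathrm{i}\int_\Omega\Im u\,\mathrm{div}\,\varphi+A\cdot\varphi\,\Re u\,dx=\int_\Omega\varphi(x)\cdot d(\mu_{1,A,u}+\mathrm{i}\mu_{2,A,u})(x)$$ for every $\varphi\in C_c^\infty(\Omega,\mathbb{R}^N)$, and $$|Du|_A(\Omega)=|\mu_{1,A,u}|(\Omega)+|\mu_{2,A,u}|(\Omega).$$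
   Context: For $u\in L^1(\Omega,\mathbb{C})$, let $$C_{1,A,u}(\Omega):=\sup\Big\{\int_\Omega \Re u\,\mathrm{div}\,\varphi-A\cdot\varphi\,\Im u\,dx : \varphi\in C_c^\infty(\Omega,\mathbb{R}^N),\ \|\varphi\|_{L^\infty(\Omega)}\le1\Big\},$$ $$C_{2,A,u}(\Omega):=\sup\Big\{\int_\Omega \Im u\,\mathrm{div}\,\varphi+A\cdot\varphi\,\Re u\,dx : \varphi\in C_c^\infty(\Omega,\mathbb{R}^N),\ \|\varphi\|_{L^\infty(\Omega)}\le1\Big\},$$ $|Du|_A(\Omega):=C_{1,A,u}(\Omega)+C_{2,A,u}(\Omega)$, and $BV_A(\Omega):=\{u\in L^1(\Omega,\mathbb{C}):|Du|_A(\Omega)<\infty\}$. Here $\mu_{1,A,u},\mu_{2,A,u}$ are $\mathbb{R}^N$-valued measures and $|\mu|$ denotes the total variation measure (with respect to the Euclidean norm on $\mathbb{R}^N$). *)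

theory Defs
  imports "HOL-Analysis.Analysis" "HOL-Probability.Essential_Supremum"
begin

section \<open>Test functions\<close>

definition partial_deriv ::
    "'n::finite \<Rightarrow> (real^'n \<Rightarrow> 'b::real_normed_vector) \<Rightarrow> real^'n \<Rightarrow> 'b" where
  "partial_deriv i f x = frechet_derivative f (at x) (axis i 1)"

text \<open>The Frechet derivative is only meaningful at points of differentiability, hence the
  explicit differentiability requirement in the successor case.\<close>

fun C_k :: "nat \<Rightarrow> (real^'n::finite \<Rightarrow> 'b::real_normed_vector) \<Rightarrow> bool" where
  "C_k 0 f \<longleftrightarrow> continuous_on UNIV f"
| "C_k (Suc k) f \<longleftrightarrow> (\<forall>x. f differentiable (at x)) \<and> (\<forall>i. C_k k (partial_deriv i f))"

text \<open>As usual, compactly supported functions on \<open>\<Omega>\<close> are identified with their extension by zero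
  to the whole space.\<close>

definition Cc_infinity :: "(real^'n::finite) set \<Rightarrow> (real^'n \<Rightarrow> 'b::real_normed_vector) set" where
  "Cc_infinity \<Omega> = {\<phi>. (\<forall>k. C_k k \<phi>) \<and>
     compact (closure {x. \<phi> x \<noteq> 0}) \<and> closure {x. \<phi> x \<noteq> 0} \<subseteq> \<Omega>}"

definition divergence :: "(real^'n::finite \<Rightarrow> real^'n) \<Rightarrow> real^'n \<Rightarrow> real" where
  "divergence \<phi> x = (\<Sum>i\<in>UNIV. partial_deriv i \<phi> x $ i)"

definition Linfinity_norm :: "(real^'n::finite) set \<Rightarrow> (real^'n \<Rightarrow> real^'n) \<Rightarrow> ereal" where
  "Linfinity_norm \<Omega> \<phi> = esssup (lebesgue_on \<Omega>) (\<lambda>x. ereal (norm (\<phi> x)))"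

definition locally_bounded :: "('a::topological_space \<Rightarrow> 'b::metric_space) \<Rightarrow> bool" where
  "locally_bounded f \<longleftrightarrow> (\<forall>x. \<exists>U. open U \<and> x \<in> U \<and> bounded (f ` U))"


section \<open>Functions of bounded magnetic variation\<close>

definition C1A :: "(real^'n::finite \<Rightarrow> real^'n) \<Rightarrow> (real^'n \<Rightarrow> complex) \<Rightarrow> (real^'n) set \<Rightarrow> ereal" where
  "C1A A u \<Omega> = (SUP \<phi> \<in> {\<phi> \<in> Cc_infinity \<Omega>. Linfinity_norm \<Omega> \<phi> \<le> 1}.
     ereal (LINT x:\<Omega>|lebesgue. Re (u x) * divergence \<phi> x - (A x \<bullet> \<phi> x) * Im (u x)))"

definition C2A :: "(real^'n::finite \<Rightarrow> real^'n) \<Rightarrow> (real^'n \<Rightarrow> complex) \<Rightarrow> (real^'n) set \<Rightarrow> ereal" where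
  "C2A A u \<Omega> = (SUP \<phi> \<in> {\<phi> \<in> Cc_infinity \<Omega>. Linfinity_norm \<Omega> \<phi> \<le> 1}.
     ereal (LINT x:\<Omega>|lebesgue. Im (u x) * divergence \<phi> x + (A x \<bullet> \<phi> x) * Re (u x)))"

definition magnetic_variation ::
    "(real^'n::finite \<Rightarrow> real^'n) \<Rightarrow> (real^'n \<Rightarrow> complex) \<Rightarrow> (real^'n) set \<Rightarrow> ereal" where
  "magnetic_variation A u \<Omega> = C1A A u \<Omega> + C2A A u \<Omega>"

definition BV_A :: "(real^'n::finite \<Rightarrow> real^'n) \<Rightarrow> (real^'n) set \<Rightarrow> (real^'n \<Rightarrow> complex) set" where
  "BV_A A \<Omega> = {u. set_integrable lebesgue \<Omega> u \<and> magnetic_variation A u \<Omega> < \<infinity>}"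


section \<open>Vector measures\<close>

text \<open>Below, the measure \<open>M\<close> only serves as a measurable space. As with \<^const>\<open>emeasure\<close>, set
  functions take the value \<open>0\<close> on non-measurable sets, so that two vector measures are equal as
  HOL functions iff they agree on all measurable sets.\<close>

definition vector_measure :: "'a measure \<Rightarrow> ('a set \<Rightarrow> 'b::real_normed_vector) \<Rightarrow> bool" where
  "vector_measure M \<mu> \<longleftrightarrow>
     (\<forall>B. B \<notin> sets M \<longrightarrow> \<mu> B = 0) \<and> \<mu> {} = 0 \<and>
     (\<forall>E. range E \<subseteq> sets M \<longrightarrow> disjoint_family E \<longrightarrow> (\<lambda>k::nat. \<mu> (E k)) sums \<mu> (\<Union>k. E k))"

definition total_variation ::
    "'a measure \<Rightarrow> ('a set \<Rightarrow> 'b::real_normed_vector) \<Rightarrow> 'a set \<Rightarrow> ennreal" where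
  "total_variation M \<mu> B =
     (SUP E \<in> {E :: nat \<Rightarrow> 'a set. range E \<subseteq> sets M \<and> disjoint_family E \<and> (\<Union>k. E k) = B}.
        \<Sum>k. ennreal (norm (\<mu> (E k))))"

text \<open>A finite vector-valued Radon measure on \<open>\<Omega>\<close> is a countably additive vector-valued set function
  on the Borel subsets of \<open>\<Omega>\<close>, of finite total variation. For the open sets \<open>\<Omega>\<close> considered here
  regularity is automatic.\<close>

definition finite_radon_measure ::
    "(real^'n::finite) set \<Rightarrow> ((real^'n) set \<Rightarrow> 'b::real_normed_vector) \<Rightarrow> bool" where
  "finite_radon_measure \<Omega> \<mu> \<longleftrightarrow>
     vector_measure (restrict_space borel \<Omega>) \<mu> \<and>
     total_variation (restrict_space borel \<Omega>) \<mu> \<Omega> < \<infinity>"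

text \<open>Jordan decomposition \<open>\<nu> = \<nu>\<^sup>+ - \<nu>\<^sup>-\<close> with \<open>\<nu>\<^sup>\<plusminus> = (\<bar>\<nu>\<bar> \<plusminus> \<nu>) / 2\<close>; meaningful for real measures of
  finite total variation. The negative part of \<open>\<nu>\<close> is the positive part of \<open>-\<nu>\<close>.\<close>

definition positive_part :: "'a measure \<Rightarrow> ('a set \<Rightarrow> real) \<Rightarrow> 'a measure" where
  "positive_part M \<nu> = measure_of (space M) (sets M)
     (\<lambda>B. ennreal ((enn2real (total_variation M \<nu> B) + \<nu> B) / 2))"

definition signed_integral :: "'a measure \<Rightarrow> ('a set \<Rightarrow> real) \<Rightarrow> ('a \<Rightarrow> real) \<Rightarrow> real" where
  "signed_integral M \<nu> f =
     (LINT x|positive_part M \<nu>. f x) - (LINT x|positive_part M (\<lambda>B. - \<nu> B). f x)"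

text \<open>\<open>\<integral>\<^sub>\<Omega> \<phi> \<cdot> d\<mu> = \<Sum>\<^sub>i \<integral>\<^sub>\<Omega> \<phi>\<^sub>i d\<mu>\<^sub>i\<close>\<close>

definition vector_integral ::
    "(real^'n::finite) set \<Rightarrow> ((real^'n) set \<Rightarrow> real^'n) \<Rightarrow> (real^'n \<Rightarrow> real^'n) \<Rightarrow> real" where
  "vector_integral \<Omega> \<mu> \<phi> =
     (\<Sum>i\<in>UNIV. signed_integral (restrict_space borel \<Omega>) (\<lambda>B. \<mu> B $ i) (\<lambda>x. \<phi> x $ i))"

text \<open>\<open>\<integral>\<^sub>\<Omega> \<phi> \<cdot> d(\<mu>\<^sub>1 + \<i>\<mu>\<^sub>2)\<close> for \<open>\<real>\<^sup>N\<close>-valued measures \<open>\<mu>\<^sub>1\<close>, \<open>\<mu>\<^sub>2\<close>\<close>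

definition complex_vector_integral ::
    "(real^'n::finite) set \<Rightarrow> ((real^'n) set \<Rightarrow> real^'n) \<Rightarrow> ((real^'n) set \<Rightarrow> real^'n) \<Rightarrow>
      (real^'n \<Rightarrow> real^'n) \<Rightarrow> complex" where
  "complex_vector_integral \<Omega> \<mu>1 \<mu>2 \<phi> =
     complex_of_real (vector_integral \<Omega> \<mu>1 \<phi>) + \<i> * complex_of_real (vector_integral \<Omega> \<mu>2 \<phi>)"

end

theory Submission
  imports Defs "HOL-Computational_Algebra.Polynomial"
begin

text \<open>By definition of \<open>|Du|\<^sub>A\<close>, both the real and the imaginary part of the left-hand side are bounded
  linear functionals \<open>L\<close> on test fields, with norms \<open>C\<^sub>1\<close> and \<open>C\<^sub>2\<close>; a Riesz representation does the rest.
  For open \<open>V\<close>, the supremum of \<open>L \<phi>\<close> over \<open>\<phi>\<close> supported in \<open>V\<close> with \<open>|\<phi>| \<le> 1\<close> generates an outer measure,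
  hence by Caratheodory a Borel measure \<open>\<lambda>\<close> with \<open>\<bar>L \<phi>\<bar> \<le> \<integral>|\<phi>| d\<lambda>\<close> and total mass the norm of \<open>L\<close>. For a
  positive scalar functional this inequality is an equality. For a vector-valued \<open>L\<close> and \<open>|e| \<le> 1\<close> the
  functional \<open>f \<mapsto> \<integral>f d\<lambda> - L (f e)\<close> is positive, hence given by a measure \<open>\<nu>\<^sub>e\<close>, and the representing vector
  measure satisfies \<open>e \<bullet> \<mu> = \<lambda> - \<nu>\<^sub>e \<le> \<lambda>\<close>. So \<open>|\<mu>|\<close> has mass at most \<open>\<lambda>(\<Omega>)\<close>, and at least that by testing
  against fields approximated by simple functions.\<close>

section \<open>Smooth cutoff functions\<close>

text \<open>The functional contains a divergence, so only smooth fields may be inserted. The other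
  concern is the exact constant. Representing the coordinate functionals one by one would bound the
  mass of \<mu> only by a sum of N norms. Hence the directions \<open>e\<close> range over the whole
  unit ball, and for each set B the direction of \<mu>(B) itself is inserted. Domination by
  \<lambda> makes each f \<mapsto> \<integral>f d\<lambda> - L (f e) positive, so only positive
  functionals need a representing measure and no density of \<mu> with respect to \<lambda> has to
  be constructed. The two magnetic functionals arise from each other by passing from u to -\<i> u,
  so one representation result serves both. Uniqueness rests on smooth cutoffs converging pointwise
  to the indicator of an open set, and on open sets being a generator of the Borel sets that is
  stable under intersection.\<close>

lemma C_k_continuous: "C_k k f \<Longrightarrow> continuous_on UNIV f"
  by (cases k) (auto simp: continuous_on_eq_continuous_at differentiable_imp_continuous_within)

lemma C_k_SucD: "C_k (Suc k) f \<Longrightarrow> C_k k f"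
proof (induction k arbitrary: f)
  case 0
  then show ?case using C_k_continuous[OF 0] by simp
next
  case (Suc k)
  then show ?case by (metis C_k.simps(2))
qed

lemma partial_deriv_eq: "(f has_derivative D) (at x) \<Longrightarrow> partial_deriv i f x = D (axis i 1)"
  by (simp add: partial_deriv_def frechet_derivative_at[symmetric])

lemma C_k_Suc_derivative:
  assumes "C_k (Suc k) f"
  shows "(f has_derivative frechet_derivative f (at x)) (at x)" "C_k k (partial_deriv i f)"
  using assms by (auto simp: frechet_derivative_works)

text \<open>The successor case of \<open>C_k\<close> speaks of the chosen
  \<open>frechet_derivative\<close>. Supplying instead the derivative \<open>D\<close> that a
  calculus rule produces reduces each closure property below to the same property one order
  lower.\<close>

lemma C_k_SucI:
  assumes "\<And>x. (f has_derivative D x) (at x)" and "\<And>i. C_k k (\<lambda>x. D x (axis i 1))"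
  shows "C_k (Suc k) f"
proof -
  have "partial_deriv i f = (\<lambda>x. D x (axis i 1))" for i
    using partial_deriv_eq[OF assms(1)] by blast
  then show ?thesis
    using assms by (auto simp: differentiable_def)
qed

lemma C_k_const: "C_k k (\<lambda>x. c)"
proof (induction k arbitrary: c)
  case (Suc k)
  show ?case
    by (rule C_k_SucI[where D = "\<lambda>x h. 0"]) (auto simp: Suc)
qed simp

lemma C_k_add:
  assumes "C_k k f" "C_k k g"
  shows "C_k k (\<lambda>x. f x + g x)"
  using assms
proof (induction k arbitrary: f g)
  case (Suc k)
  show ?case
    by (rule C_k_SucI[OF has_derivative_add[OF C_k_Suc_derivative(1) C_k_Suc_derivative(1)]])
      (use Suc in \<open>auto simp: partial_deriv_def[abs_def]\<close>)
qed (auto intro: continuous_on_add)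

lemma C_k_bounded_linear:
  assumes "bounded_linear h" "C_k k f"
  shows "C_k k (\<lambda>x. h (f x))"
  using assms(2)
proof (induction k arbitrary: f)
  case 0
  then show ?case
    using bounded_linear.continuous_on[OF assms(1)] by auto
next
  case (Suc k)
  show ?case
    by (rule C_k_SucI[OF bounded_linear.has_derivative[OF assms(1) C_k_Suc_derivative(1)]])
      (use Suc in \<open>auto simp: partial_deriv_def[abs_def]\<close>)
qed

lemma C_k_scaleR:
  fixes f :: "real^'n::finite \<Rightarrow> real"
  assumes "C_k k f" "C_k k g"
  shows "C_k k (\<lambda>x. f x *\<^sub>R g x)"
  using assms
proof (induction k arbitrary: f g)
  case (Suc k)
  show ?case
  proof (rule C_k_SucI[OF has_derivative_scaleR[OF C_k_Suc_derivative(1) C_k_Suc_derivative(1)]])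
    show "C_k k (\<lambda>x. f x *\<^sub>R frechet_derivative g (at x) (axis i 1) +
        frechet_derivative f (at x) (axis i 1) *\<^sub>R g x)" for i
      using Suc.IH[OF C_k_SucD[OF Suc.prems(1)] C_k_Suc_derivative(2)[OF Suc.prems(2), of i]]
        Suc.IH[OF C_k_Suc_derivative(2)[OF Suc.prems(1), of i] C_k_SucD[OF Suc.prems(2)]]
      by (intro C_k_add) (simp_all only: partial_deriv_def)
  qed (use Suc in auto)
qed (auto intro: continuous_on_scaleR)

text \<open>Differentiating \<open>G n \<circ> f\<close> yields a product with
  \<open>G (Suc n) \<circ> f\<close>. A claim about one outer function would not be inductive, so
  smoothness of the outer function is encoded by the whole sequence of its derivatives and the
  induction runs over all \<open>n\<close> at once.\<close>

lemma C_k_compose: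
  fixes f :: "real^'n::finite \<Rightarrow> real"
  assumes G: "\<And>n t. (G n has_real_derivative G (Suc n) t) (at t)" and "C_k k f"
  shows "C_k k (\<lambda>x. G n (f x))"
  using assms(2)
proof (induction k arbitrary: n)
  case 0
  have "continuous_on UNIV (G n)"
    using G by (meson DERIV_isCont continuous_at_imp_continuous_on)
  then show ?case
    using 0 by (auto intro: continuous_on_compose2)
next
  case (Suc k)
  have "((\<lambda>x. G n (f x)) has_derivative (\<lambda>h. frechet_derivative f (at x) h * G (Suc n) (f x))) (at x)" for x
    using has_derivative_compose[OF C_k_Suc_derivative(1)[OF Suc.prems] G[unfolded has_field_derivative_def]]
    by (simp add: mult.commute)
  then show ?case
  proof (rule C_k_SucI)
    show "C_k k (\<lambda>x. frechet_derivative f (at x) (axis i 1) * G (Suc n) (f x))" for i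
      using C_k_scaleR[OF C_k_Suc_derivative(2)[OF Suc.prems, of i] Suc.IH[OF C_k_SucD[OF Suc.prems]]]
      by (simp add: partial_deriv_def[abs_def])
  qed
qed

lemma C_k_component: "C_k k (\<lambda>x. x $ i)"
proof (cases k)
  case (Suc m)
  show ?thesis
    unfolding Suc
    by (rule C_k_SucI[where D = "\<lambda>x h. h $ i"])
      (auto intro: bounded_linear_imp_has_derivative bounded_linear_vec_nth C_k_const)
qed (auto intro: continuous_intros)

lemma C_k_sum:
  assumes "\<And>i. i \<in> I \<Longrightarrow> C_k k (f i)"
  shows "C_k k (\<lambda>x. \<Sum>i\<in>I. f i x)"
  using assms by (induction I rule: infinite_finite_induct) (auto intro: C_k_const C_k_add)

lemma C_k_norm_sq: "C_k k (\<lambda>x::real^'n::finite. (norm (x - a))\<^sup>2)"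
proof -
  have *: "C_k k (\<lambda>x::real^'n. x $ i + - a $ i)" for i
    by (intro C_k_add C_k_const C_k_component)
  show ?thesis
    using C_k_sum[of UNIV k, OF C_k_scaleR[OF * *]]
    by (simp add: power2_norm_eq_inner inner_vec_def)
qed

section \<open>A function on the line that is flat at the origin\<close>

text \<open>The classical smooth function exp (-1/t), extended by 0, with a polynomial in 1/t as
  extra factor. That factor makes the family closed under differentiation, so all derivatives of
  \<open>flat 1\<close> have the same form.\<close>

definition flat :: "real poly \<Rightarrow> real \<Rightarrow> real" where
  "flat p t = (if t > 0 then exp (- 1 / t) * poly p (1 / t) else 0)"

text \<open>As \<open>flat p 0 = 0\<close>, this is the difference quotient at 0. From the right, x
  = 1/t turns it into x p(x) / exp x at infinity, where the exponential wins; the extra factor x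
  accounts for \<open>pCons 0 p\<close>.\<close>

lemma flat_at_0: "((\<lambda>t. flat p t / t) \<longlongrightarrow> 0) (at 0)"
proof -
  have lim: "((\<lambda>x. poly q x / exp x) \<longlongrightarrow> (0::real)) at_top" for q :: "real poly"
  proof -
    have "((\<lambda>x. \<Sum>i\<le>degree q. coeff q i * (x ^ i / exp x)) \<longlongrightarrow> (\<Sum>i\<le>degree q. coeff q i * 0)) at_top"
      by (intro tendsto_intros tendsto_power_div_exp_0)
    then show ?thesis
      by (simp add: poly_altdef sum_divide_distrib)
  qed
  have "((\<lambda>t. flat p t / t) \<longlongrightarrow> 0) (at_left 0)"
    by (rule tendsto_eventually)
      (auto simp: eventually_at flat_def intro!: exI[of _ 1])
  moreover have "((\<lambda>t. flat p t / t) \<longlongrightarrow> 0) (at_right 0)"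
  proof -
    have "((\<lambda>x. flat p (inverse x) / inverse x) \<longlongrightarrow> 0) at_top"
    proof (rule Lim_transform_eventually[OF lim[of "pCons 0 p"]])
      show "\<forall>\<^sub>F x in at_top. poly (pCons 0 p) x / exp x = flat p (inverse x) / inverse x"
        using eventually_gt_at_top[of 0]
        by eventually_elim (auto simp: flat_def exp_minus field_simps)
    qed
    then show ?thesis
      by (simp add: filterlim_at_right_to_top)
  qed
  ultimately show ?thesis
    by (simp add: filterlim_at_split)
qed

text \<open>For t > 0 the product and chain rules give exp (-1/t) (p(1/t) - p'(1/t)) / t^2, and
  1/t^2 is \<open>monom 1 2\<close> evaluated at 1/t. At 0 both sides vanish by flatness.\<close>

lemma DERIV_flat:
  "(flat p has_real_derivative flat (monom 1 2 * (p - pderiv p)) t) (at t)"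
proof -
  consider "t > 0" | "t = 0" | "t < 0" by linarith
  then show ?thesis
  proof cases
    case 1
    have "((\<lambda>t. exp (- 1 / t) * poly p (1 / t)) has_real_derivative
        flat (monom 1 2 * (p - pderiv p)) t) (at t)"
      using 1 by (auto intro!: derivative_eq_intros DERIV_chain'[OF _ poly_DERIV] 
            simp: flat_def poly_monom field_simps power2_eq_square)
    then show ?thesis
      by (rule has_field_derivative_transform_within_open[where S = "{0<..}"]) (use 1 in \<open>auto simp: flat_def\<close>)
  next
    case 2
    then show ?thesis
      using flat_at_0[of p] by (simp add: has_field_derivative_iff) (simp add: flat_def)
  next
    case 3
    have "((\<lambda>t. 0) has_real_derivative flat (monom 1 2 * (p - pderiv p)) t) (at t)"
      using 3 by (simp add: flat_def)
    then show ?thesis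
      by (rule has_field_derivative_transform_within_open[where S = "{..<0}"]) (use 3 in \<open>auto simp: flat_def\<close>)
  qed
qed

lemma C_k_flat:
  fixes f :: "real^'n::finite \<Rightarrow> real"
  assumes "C_k k f"
  shows "C_k k (\<lambda>x. flat p (f x))"
proof -
  define G where "G n = flat (((\<lambda>q. monom 1 2 * (q - pderiv q)) ^^ n) p)" for n
  have "(G n has_real_derivative G (Suc n) t) (at t)" for n t
    unfolding G_def using DERIV_flat by simp
  from C_k_compose[of G, OF this assms, of 0] show ?thesis
    by (simp add: G_def)
qed

section \<open>Algebra of test functions\<close>

lemma Cc_infinityI:
  assumes "\<And>k. C_k k \<phi>" "compact K" "K \<subseteq> \<Omega>" "\<And>x. x \<notin> K \<Longrightarrow> \<phi> x = 0"
  shows "\<phi> \<in> Cc_infinity \<Omega>"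
proof -
  have "closure {x. \<phi> x \<noteq> 0} \<subseteq> K"
    using assms by (intro closure_minimal) (auto intro: compact_imp_closed)
  then show ?thesis
    using assms compact_Int_closed[OF \<open>compact K\<close> closed_closure[of "{x. \<phi> x \<noteq> 0}"]]
    by (auto simp: Cc_infinity_def Int_absorb1)
qed

lemma Cc_infinityE:
  assumes "\<phi> \<in> Cc_infinity \<Omega>"
  obtains K where "compact K" "K \<subseteq> \<Omega>" "\<And>x. x \<notin> K \<Longrightarrow> \<phi> x = 0"
proof
  show "\<phi> x = 0" if "x \<notin> closure {x. \<phi> x \<noteq> 0}" for x
    using that closure_subset[of "{x. \<phi> x \<noteq> 0}"] by auto
qed (use assms in \<open>simp_all add: Cc_infinity_def\<close>)

lemma Cc_infinity_C_k: "\<phi> \<in> Cc_infinity \<Omega> \<Longrightarrow> C_k k \<phi>"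
  by (auto simp: Cc_infinity_def)

lemma Cc_infinity_continuous: "\<phi> \<in> Cc_infinity \<Omega> \<Longrightarrow> continuous_on S \<phi>"
  using C_k_continuous[OF Cc_infinity_C_k] continuous_on_subset by blast

lemma Cc_infinity_mono: "\<phi> \<in> Cc_infinity V \<Longrightarrow> V \<subseteq> W \<Longrightarrow> \<phi> \<in> Cc_infinity W"
  by (auto simp: Cc_infinity_def)

lemma Cc_infinity_zero: "(\<lambda>x. 0) \<in> Cc_infinity \<Omega>"
  by (rule Cc_infinityI[where K = "{}"]) (auto intro: C_k_const)

lemma Cc_infinity_vanish: "\<phi> \<in> Cc_infinity \<Omega> \<Longrightarrow> x \<notin> \<Omega> \<Longrightarrow> \<phi> x = 0"
  by (meson Cc_infinityE subsetD)

lemma Cc_infinity_add: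
  assumes "\<phi> \<in> Cc_infinity \<Omega>" "\<psi> \<in> Cc_infinity \<Omega>"
  shows "(\<lambda>x. \<phi> x + \<psi> x) \<in> Cc_infinity \<Omega>"
proof -
  obtain K L where "compact K" "K \<subseteq> \<Omega>" "\<And>x. x \<notin> K \<Longrightarrow> \<phi> x = 0"
    "compact L" "L \<subseteq> \<Omega>" "\<And>x. x \<notin> L \<Longrightarrow> \<psi> x = 0"
    using assms by (meson Cc_infinityE)
  then show ?thesis
    using assms by (intro Cc_infinityI[where K = "K \<union> L"] C_k_add) (auto intro: Cc_infinity_C_k)
qed

lemma Cc_infinity_bounded_linear:
  assumes "bounded_linear h" "\<phi> \<in> Cc_infinity \<Omega>"
  shows "(\<lambda>x. h (\<phi> x)) \<in> Cc_infinity \<Omega>"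
proof -
  obtain K where "compact K" "K \<subseteq> \<Omega>" "\<And>x. x \<notin> K \<Longrightarrow> \<phi> x = 0"
    using assms by (meson Cc_infinityE)
  then show ?thesis
    using linear_0[OF bounded_linear.linear[OF assms(1)]]
      C_k_bounded_linear[OF assms(1) Cc_infinity_C_k[OF assms(2)]]
    by (intro Cc_infinityI[where K = K]) simp_all
qed

lemma Cc_infinity_scaleR: "\<phi> \<in> Cc_infinity \<Omega> \<Longrightarrow> (\<lambda>x. c *\<^sub>R \<phi> x) \<in> Cc_infinity \<Omega>"
  by (intro Cc_infinity_bounded_linear[OF bounded_linear_scaleR_right])

lemma Cc_infinity_diff:
  assumes "\<phi> \<in> Cc_infinity \<Omega>" "\<psi> \<in> Cc_infinity \<Omega>"
  shows "(\<lambda>x. \<phi> x - \<psi> x) \<in> Cc_infinity \<Omega>"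
  using Cc_infinity_add[OF assms(1) Cc_infinity_scaleR[OF assms(2), of "-1"]] by simp

lemma Cc_infinity_sum:
  assumes "\<And>i. i \<in> I \<Longrightarrow> \<phi> i \<in> Cc_infinity \<Omega>"
  shows "(\<lambda>x. \<Sum>i\<in>I. \<phi> i x) \<in> Cc_infinity \<Omega>"
  using assms
  by (induction I rule: infinite_finite_induct) (auto intro: Cc_infinity_zero Cc_infinity_add)

lemma Cc_infinity_bounded:
  assumes "\<phi> \<in> Cc_infinity \<Omega>"
  obtains B where "B > 0" "\<And>x. norm (\<phi> x) \<le> B"
proof -
  obtain K where K: "compact K" "\<And>x. x \<notin> K \<Longrightarrow> \<phi> x = 0"
    using assms by (meson Cc_infinityE)
  have "bounded (\<phi> ` K)"
    using K Cc_infinity_continuous[OF assms] compact_continuous_image compact_imp_bounded by blast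
  then obtain B where "B > 0" "\<And>x. x \<in> K \<Longrightarrow> norm (\<phi> x) \<le> B"
    by (auto simp: bounded_pos)
  then show ?thesis
    using K by (intro that[of B]) (metis norm_zero less_imp_le)+
qed

section \<open>Bumps, cutoffs and smooth splittings\<close>

lemma bump_exists:
  fixes a :: "real^'n::finite"
  assumes "r > 0"
  obtains \<psi> where "\<And>k. C_k k \<psi>" "\<And>x. \<psi> x \<ge> (0::real)" "\<And>x. \<psi> x > 0 \<longleftrightarrow> x \<in> ball a r"
proof
  \<comment> \<open>The squared distance is smooth at the centre too, where the distance is not. The
    difference is written with the scalar -1 so that the closure rules for sums and products
    apply.\<close>
  let ?f = "\<lambda>x. flat 1 (r\<^sup>2 + (-1) *\<^sub>R (norm (x - a))\<^sup>2)"
  show "C_k k ?f" for k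
    by (intro C_k_flat C_k_add C_k_const C_k_scaleR C_k_norm_sq)
  show "0 \<le> ?f x" for x
    by (auto simp: flat_def)
  have "(norm (x - a))\<^sup>2 < r\<^sup>2 \<longleftrightarrow> norm (x - a) < r" for x
    using assms by (metis norm_ge_zero order_less_le power2_less_imp_less power_strict_mono zero_less_numeral)
  then show "0 < ?f x \<longleftrightarrow> x \<in> ball a r" for x
    by (auto simp: flat_def dist_norm norm_minus_commute[of a])
qed

lemma positive_on_compact_exists:
  fixes K :: "(real^'n::finite) set"
  assumes "compact K" "open V" "K \<subseteq> V"
  obtains \<psi> where "\<psi> \<in> Cc_infinity V" "\<And>x. \<psi> x \<ge> (0::real)" "\<And>x. x \<in> K \<Longrightarrow> \<psi> x > 0"
proof -
  \<comment> \<open>The closed ball is kept inside \<open>V\<close> because it will be the compact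
    set outside which the bump vanishes.\<close>
  have "\<exists>r>0. cball x r \<subseteq> V" if "x \<in> K" for x
    using assms that open_contains_cball by blast
  then obtain r where r: "\<And>x. x \<in> K \<Longrightarrow> r x > 0 \<and> cball x (r x) \<subseteq> V"
    by metis
  have "\<exists>\<psi>. (\<forall>k. C_k k \<psi>) \<and> (\<forall>y. \<psi> y \<ge> (0::real)) \<and> (\<forall>y. \<psi> y > 0 \<longleftrightarrow> y \<in> ball x (r x))" if "x \<in> K" for x
    using bump_exists[of "r x" x] r that by metis
  then obtain \<psi> where \<psi>: "\<And>x k. x \<in> K \<Longrightarrow> C_k k (\<psi> x)" "\<And>x y. x \<in> K \<Longrightarrow> \<psi> x y \<ge> (0::real)"
    "\<And>x y. x \<in> K \<Longrightarrow> \<psi> x y > 0 \<longleftrightarrow> y \<in> ball x (r x)"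
    by metis
  have "K \<subseteq> (\<Union>x\<in>K. ball x (r x))"
    using r by fastforce
  then obtain F where F: "F \<subseteq> K" "finite F" "K \<subseteq> (\<Union>x\<in>F. ball x (r x))"
    using compactE_image[OF \<open>compact K\<close>, of K "\<lambda>x. ball x (r x)"] by auto
  show ?thesis
  proof
    show "(\<lambda>y. \<Sum>x\<in>F. \<psi> x y) \<in> Cc_infinity V"
    proof (rule Cc_infinity_sum)
      fix x assume "x \<in> F"
      then show "\<psi> x \<in> Cc_infinity V"
        using \<psi>[of x] r[of x] F(1)
        by (intro Cc_infinityI[where K = "cball x (r x)"])
          (auto simp: less_le, metis ball_subset_cball mem_cball subsetD)
    qed
    show "0 \<le> (\<Sum>x\<in>F. \<psi> x y)" for y
      using \<psi> F by (intro sum_nonneg) auto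
    show "0 < (\<Sum>x\<in>F. \<psi> x y)" if y: "y \<in> K" for y
    proof -
      obtain x where "x \<in> F" "y \<in> ball x (r x)"
        using F y by auto
      then show ?thesis
        using \<psi> F by (intro sum_pos2[of F x]) auto
    qed
  qed
qed

text \<open>With \<open>H = flat 1\<close>, the composite \<open>H (H 1 - H (2 - t))\<close> vanishes for \<open>t \<le> 1\<close> and is the
  positive constant \<open>H (H 1)\<close> for \<open>t \<ge> 2\<close>; this yields a smooth step without any division.\<close>

lemma cutoff_exists:
  fixes K :: "(real^'n::finite) set"
  assumes "compact K" "open V" "K \<subseteq> V"
  obtains \<eta> G where "\<eta> \<in> Cc_infinity V" "\<And>x. 0 \<le> \<eta> x" "\<And>x. \<eta> x \<le> (1::real)"
    "open G" "K \<subseteq> G" "\<And>x. x \<in> G \<Longrightarrow> \<eta> x = 1"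
proof -
  obtain \<psi> where \<psi>: "\<psi> \<in> Cc_infinity V" "\<And>x. \<psi> x \<ge> (0::real)" "\<And>x. x \<in> K \<Longrightarrow> \<psi> x > 0"
    using positive_on_compact_exists[OF assms] by blast
  have "\<exists>\<delta>>0. \<forall>x\<in>K. \<delta> \<le> \<psi> x"
  proof (cases "K = {}")
    case False
    then show ?thesis
      using continuous_attains_inf[OF assms(1) False Cc_infinity_continuous[OF \<psi>(1)]] \<psi>(3) by blast
  qed (auto intro: exI[of _ 1])
  then obtain \<delta> where \<delta>: "\<delta> > 0" "\<And>x. x \<in> K \<Longrightarrow> \<delta> \<le> \<psi> x"
    by blast
  define H where "H = flat 1"
  define c where "c = H 1"
  have H: "H t = (if t > 0 then exp (- 1 / t) else 0)" for t
    by (simp add: H_def flat_def)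
  have H_mono: "H s \<le> H t" if "s \<le> t" for s t
    using that by (auto simp: H field_simps)
  have H_nonneg: "0 \<le> H t" for t
    by (simp add: H)
  have c: "c > 0" "H c > 0"
    by (simp_all add: c_def H)
  define S where "S t = H (c + (-1) *\<^sub>R H (2 + (-1) *\<^sub>R t))" for t
  \<comment> \<open>The factor 4 / \<delta> sends the open set where \<psi> exceeds \<delta> / 2
    into t > 2, where \<open>S\<close> is constant. This set contains \<open>K\<close>, since \<psi>
    \<ge> \<delta> there, and serves as \<open>G\<close>. Dividing by \<open>H c\<close> normalises
    the constant to 1.\<close>
  define \<eta> where "\<eta> x = inverse (H c) *\<^sub>R S ((4 / \<delta>) *\<^sub>R \<psi> x)" for x
  have S0: "S t = 0" if "t \<le> 1" for t
    using H_mono[of 1 "2 - t"] that by (simp add: S_def H[of "H 1 - H (2 - t)"] c_def)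
  have S1: "S t = H c" if "t \<ge> 2" for t
    using that by (simp add: S_def H[of "2 - t"])
  obtain L where L: "compact L" "L \<subseteq> V" "\<And>x. x \<notin> L \<Longrightarrow> \<psi> x = 0"
    using Cc_infinityE[OF \<psi>(1)] by blast
  show ?thesis
  proof
    show "\<eta> \<in> Cc_infinity V"
      unfolding \<eta>_def
    proof (rule Cc_infinity_scaleR, rule Cc_infinityI[OF _ L(1,2)])
      show "C_k k (\<lambda>x. S ((4 / \<delta>) *\<^sub>R \<psi> x))" for k
        unfolding S_def H_def by (intro C_k_flat C_k_add C_k_scaleR C_k_const Cc_infinity_C_k[OF \<psi>(1)])
    qed (use L S0 in auto)
    show "0 \<le> \<eta> x" "\<eta> x \<le> 1" for x
      using H_nonneg c H_mono[of "c - H (2 - 4 * \<psi> x / \<delta>)" c] by (auto simp: \<eta>_def S_def field_simps)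
    show "open {x. \<psi> x > \<delta> / 2}"
      using Cc_infinity_continuous[OF \<psi>(1)] by (intro open_Collect_less continuous_intros)
    show "K \<subseteq> {x. \<psi> x > \<delta> / 2}"
      using \<delta> by fastforce
    show "\<eta> x = 1" if "x \<in> {x. \<psi> x > \<delta> / 2}" for x
      using that \<delta> c S1[of "(4 / \<delta>) * \<psi> x"] by (simp add: \<eta>_def field_simps)
  qed
qed

text \<open>Along an exhaustion of \<open>V\<close> by compact sets, take cutoffs equal to 1 on the
  k-th set. At a point of \<open>V\<close> the sequence is eventually 1, outside \<open>V\<close> it
  is always 0. This is the bridge from values on test functions to values of measures on open
  sets.\<close>

lemma smooth_indicator_approx:
  fixes V :: "(real^'n::finite) set"
  assumes "open V"
  obtains f where "\<And>k. f k \<in> Cc_infinity V" "\<And>k x. 0 \<le> f k x" "\<And>k x. f k x \<le> (1::real)"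
    "\<And>x. (\<lambda>k::nat. f k x) \<longlonglongrightarrow> indicator V x"
proof -
  obtain C :: "nat \<Rightarrow> (real^'n) set" where C: "\<And>n. compact (C n)" "\<And>n. C n \<subseteq> V" "\<And>n. C n \<subseteq> interior (C (Suc n))"
    "\<Union> (range C) = V"
    using open_Union_compact_subsets[OF assms] by metis
  have "\<exists>f. f \<in> Cc_infinity V \<and> (\<forall>x. 0 \<le> f x \<and> f x \<le> (1::real)) \<and> (\<forall>x\<in>C k. f x = 1)" for k
    using cutoff_exists[OF C(1)[of k] assms C(2)[of k]] by (metis subsetD)
  then obtain f where f: "\<And>k. f k \<in> Cc_infinity V" "\<And>k x. 0 \<le> f k x" "\<And>k x. f k x \<le> (1::real)"
    "\<And>k x. x \<in> C k \<Longrightarrow> f k x = 1"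
    by metis
  have "mono C"
    using C(3) interior_subset by (intro mono_iff_le_Suc[THEN iffD2]) blast
  have "(\<lambda>k. f k x) \<longlonglongrightarrow> indicator V x" for x
  proof (cases "x \<in> V")
    case True
    then obtain m where "x \<in> C m"
      using C(4) by auto
    then have "\<forall>k\<ge>m. f k x = 1"
      using \<open>mono C\<close> f(4) by (meson monoD subsetD)
    then show ?thesis
      using True by (intro tendsto_eventually) (auto simp: eventually_sequentially)
  next
    case False
    then have "f k x = 0" for k
      using f(1) Cc_infinity_vanish by blast
    then show ?thesis
      using False by simp
  qed
  with f show ?thesis
    using that by blast
qed

text \<open>The part of the support outside \<open>W\<close> is compact in \<open>V\<close>, so a
  cutoff \<eta> of \<open>V\<close> equals 1 near it, and \<phi> = \<eta> \<phi> + (1 - \<eta>)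
  \<phi>. It matters that \<eta> is 1 on an open set \<open>G\<close>: the second summand then
  vanishes off \<open>K - G\<close>, which is compact and lies in \<open>W\<close>.\<close>

lemma Cc_infinity_split:
  fixes \<phi> :: "real^'n::finite \<Rightarrow> 'b::real_normed_vector"
  assumes "\<phi> \<in> Cc_infinity (V \<union> W)" "open V" "open W"
  obtains \<phi>1 \<phi>2 where "\<phi>1 \<in> Cc_infinity V" "\<phi>2 \<in> Cc_infinity W" "\<phi> = (\<lambda>x. \<phi>1 x + \<phi>2 x)"
    "\<And>x. norm (\<phi>1 x) \<le> norm (\<phi> x)" "\<And>x. norm (\<phi>2 x) \<le> norm (\<phi> x)"
proof -
  obtain K where K: "compact K" "K \<subseteq> V \<union> W" "\<And>x. x \<notin> K \<Longrightarrow> \<phi> x = 0"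
    using Cc_infinityE[OF assms(1)] by blast
  have "compact (K - W)" "K - W \<subseteq> V"
    using K assms by (auto intro: compact_diff)
  then obtain \<eta> G where \<eta>: "\<eta> \<in> Cc_infinity V" "\<And>x. 0 \<le> \<eta> x" "\<And>x. \<eta> x \<le> (1::real)"
    "open G" "K - W \<subseteq> G" "\<And>x. x \<in> G \<Longrightarrow> \<eta> x = 1"
    using cutoff_exists[OF _ \<open>open V\<close>] by metis
  obtain L where L: "compact L" "L \<subseteq> V" "\<And>x. x \<notin> L \<Longrightarrow> \<eta> x = 0"
    using Cc_infinityE[OF \<eta>(1)] by blast
  have C: "C_k k (\<lambda>x. \<eta> x *\<^sub>R \<phi> x)" "C_k k (\<lambda>x. (1 + (-1) *\<^sub>R \<eta> x) *\<^sub>R \<phi> x)" for k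
    by (intro C_k_scaleR C_k_add C_k_const Cc_infinity_C_k[OF assms(1)] Cc_infinity_C_k[OF \<eta>(1)])+
  show ?thesis
  proof
    show "(\<lambda>x. \<eta> x *\<^sub>R \<phi> x) \<in> Cc_infinity V"
      using L by (intro Cc_infinityI[OF C(1) L(1)]) auto
    have "compact (K - G)" "K - G \<subseteq> W"
      using K \<eta> by (auto intro: compact_diff)
    then show "(\<lambda>x. (1 + (-1) *\<^sub>R \<eta> x) *\<^sub>R \<phi> x) \<in> Cc_infinity W"
      by (rule Cc_infinityI[OF C(2)]) (use K(3) \<eta>(6) in auto)
    show "\<phi> = (\<lambda>x. \<eta> x *\<^sub>R \<phi> x + (1 + (-1) *\<^sub>R \<eta> x) *\<^sub>R \<phi> x)"
      by (auto simp: algebra_simps)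
    show "norm (\<eta> x *\<^sub>R \<phi> x) \<le> norm (\<phi> x)" "norm ((1 + (-1) *\<^sub>R \<eta> x) *\<^sub>R \<phi> x) \<le> norm (\<phi> x)" for x
      using \<eta>(2,3)[of x] by (auto intro!: mult_left_le_one_le)
  qed
qed


section \<open>Total variation and signed integrals\<close>

lemma vector_measure_sums:
  "vector_measure M \<nu> \<Longrightarrow> range E \<subseteq> sets M \<Longrightarrow> disjoint_family E \<Longrightarrow> (\<lambda>k::nat. \<nu> (E k)) sums \<nu> (\<Union>k. E k)"
  by (auto simp: vector_measure_def)

lemma vector_measure_notin: "vector_measure M \<nu> \<Longrightarrow> B \<notin> sets M \<Longrightarrow> \<nu> B = 0"
  by (auto simp: vector_measure_def)

lemma vector_measure_empty: "vector_measure M \<nu> \<Longrightarrow> \<nu> {} = 0"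
  by (auto simp: vector_measure_def)

lemma vector_measure_Un:
  assumes "vector_measure M \<nu>" "A \<in> sets M" "B \<in> sets M" "A \<inter> B = {}"
  shows "\<nu> (A \<union> B) = \<nu> A + \<nu> B"
proof -
  have "(\<lambda>k. \<nu> (binaryset A B k)) sums \<nu> (\<Union>k. binaryset A B k)"
    using assms by (intro vector_measure_sums[OF assms(1)])
      (auto simp: disjoint_family_on_def binaryset_def)
  moreover have "(\<lambda>k. \<nu> (binaryset A B k)) sums (\<Sum>k<2. \<nu> (binaryset A B k))"
    by (rule sums_finite) (auto simp: binaryset_def vector_measure_empty[OF assms(1)])
  ultimately show ?thesis
    by (simp add: UN_binaryset_eq sums_iff) (simp add: binaryset_def numeral_2_eq_2)
qed

lemma vector_measure_bounded_linear:
  assumes "vector_measure M \<nu>" "bounded_linear h"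
  shows "vector_measure M (\<lambda>B. h (\<nu> B))"
  using assms(1) bounded_linear.sums[OF assms(2)] linear_0[OF bounded_linear.linear[OF assms(2)]]
  by (auto simp: vector_measure_def)

lemma vector_measure_add:
  "vector_measure M \<mu> \<Longrightarrow> vector_measure M \<nu> \<Longrightarrow> vector_measure M (\<lambda>B. \<mu> B + \<nu> B)"
  by (simp add: vector_measure_def sums_add)

lemma vector_measure_diff:
  "vector_measure M \<mu> \<Longrightarrow> vector_measure M \<nu> \<Longrightarrow> vector_measure M (\<lambda>B. \<mu> B - \<nu> B)"
  by (simp add: vector_measure_def sums_diff)

lemma vector_measure_sum:
  assumes "\<And>i. i \<in> I \<Longrightarrow> vector_measure M (\<nu> i)"
  shows "vector_measure M (\<lambda>B. \<Sum>i\<in>I. \<nu> i B)"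
  using assms
proof (induction I rule: infinite_finite_induct)
  case (insert i I)
  then show ?case
    using vector_measure_add[of M "\<nu> i" "\<lambda>B. \<Sum>i\<in>I. \<nu> i B"] by simp
qed (auto simp: vector_measure_def)

lemma vector_measure_measure:
  assumes "finite_measure N" "sets N = sets M"
  shows "vector_measure M (measure N)"
proof -
  interpret finite_measure N by fact
  show ?thesis
    using assms(2) by (auto simp: vector_measure_def measure_notin_sets intro: finite_measure_UNION)
qed

text \<open>Dynkin's argument without positivity. The value on a complement is the total value minus
  the value on the set, which is why agreement on \<open>space M\<close> is demanded as well.
  Equality as functions follows because both vanish off \<open>sets M\<close>.\<close>

lemma vector_measure_eqI:
  assumes \<mu>: "vector_measure M \<mu>" and \<nu>: "vector_measure M \<nu>"
    and gen: "sets M = sigma_sets (space M) G" "Int_stable G" "G \<subseteq> Pow (space M)"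
    and eq: "\<And>A. A \<in> G \<Longrightarrow> \<mu> A = \<nu> A" "\<mu> (space M) = \<nu> (space M)"
  shows "\<mu> = \<nu>"
proof
  fix B
  show "\<mu> B = \<nu> B"
  proof (cases "B \<in> sets M")
    case True
    then have "B \<in> sigma_sets (space M) G"
      by (simp add: gen)
    with gen(2,3) show ?thesis
    proof (induction rule: sigma_sets_induct_disjoint)
      case (compl A)
      then have A: "A \<in> sets M"
        by (simp add: gen)
      then have sp: "A \<union> (space M - A) = space M"
        using sets.sets_into_space by blast
      have "\<mu> A + \<mu> (space M - A) = \<nu> A + \<nu> (space M - A)"
        using vector_measure_Un[OF \<mu> A, of "space M - A"] vector_measure_Un[OF \<nu> A, of "space M - A"] A sp eq(2)
        by auto
      then show ?case
        using compl by simp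
    next
      case (union A)
      then have "(\<lambda>i. \<mu> (A i)) sums \<mu> (\<Union>i. A i)" "(\<lambda>i. \<nu> (A i)) sums \<nu> (\<Union>i. A i)"
        using vector_measure_sums[OF \<mu>, of A] vector_measure_sums[OF \<nu>, of A] gen(1) by auto
      then show ?case
        using union by (auto dest: sums_unique2)
    qed (auto simp: eq vector_measure_empty[OF \<mu>] vector_measure_empty[OF \<nu>])
  qed (simp add: vector_measure_notin[OF \<mu>] vector_measure_notin[OF \<nu>])
qed

section \<open>The total variation as a positive measure\<close>

lemma total_variation_bounded:
  assumes "\<And>E. range E \<subseteq> sets M \<Longrightarrow> disjoint_family E \<Longrightarrow> (\<Union>k::nat. E k) = B \<Longrightarrow> (\<Sum>k. ennreal (norm (\<nu> (E k)))) \<le> c"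
  shows "total_variation M \<nu> B \<le> c"
  unfolding total_variation_def using assms by (auto intro: SUP_least)

lemma suminf_le_total_variation:
  assumes "range E \<subseteq> sets M" "disjoint_family E" "(\<Union>k::nat. E k) = B"
  shows "(\<Sum>k. ennreal (norm (\<nu> (E k)))) \<le> total_variation M \<nu> B"
  unfolding total_variation_def using assms by (intro SUP_upper) auto

lemma total_variation_mono_norm:
  assumes "\<And>B. B \<in> sets M \<Longrightarrow> norm (\<mu> B) \<le> norm (\<nu> B)"
  shows "total_variation M \<mu> B \<le> total_variation M \<nu> B"
proof (rule total_variation_bounded)
  fix E :: "nat \<Rightarrow> _" assume E: "range E \<subseteq> sets M" "disjoint_family E" "(\<Union>k. E k) = B"
  have "(\<Sum>k. ennreal (norm (\<mu> (E k)))) \<le> (\<Sum>k. ennreal (norm (\<nu> (E k))))"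
    using E assms by (intro suminf_le ennreal_leI) auto
  also have "\<dots> \<le> total_variation M \<nu> B"
    by (rule suminf_le_total_variation[OF E])
  finally show "(\<Sum>k. ennreal (norm (\<mu> (E k)))) \<le> total_variation M \<nu> B" .
qed

lemma norm_le_total_variation:
  assumes "vector_measure M \<nu>" "B \<in> sets M"
  shows "ennreal (norm (\<nu> B)) \<le> total_variation M \<nu> B"
proof -
  have "(\<Sum>k. ennreal (norm (\<nu> (binaryset B {} k)))) \<le> total_variation M \<nu> B"
    using assms by (intro suminf_le_total_variation)
      (auto simp: disjoint_family_on_def binaryset_def split: if_splits)
  moreover have "(\<Sum>k. ennreal (norm (\<nu> (binaryset B {} k)))) = ennreal (norm (\<nu> B))"
    by (subst suminf_finite[of "{0}"]) (simp_all add: binaryset_def vector_measure_empty[OF assms(1)])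
  ultimately show ?thesis
    by simp
qed

lemma norm_sums_le_suminf_ennreal:
  fixes f :: "nat \<Rightarrow> 'a::real_normed_vector"
  assumes "f sums s"
  shows "ennreal (norm s) \<le> (\<Sum>k. ennreal (norm (f k)))"
proof (rule LIMSEQ_le_const2)
  show "(\<lambda>n. ennreal (norm (\<Sum>k<n. f k))) \<longlonglongrightarrow> ennreal (norm s)"
    using assms by (intro tendsto_intros) (simp add: sums_def)
  have "ennreal (norm (\<Sum>k<n. f k)) \<le> (\<Sum>k. ennreal (norm (f k)))" for n
  proof -
    have "ennreal (norm (\<Sum>k<n. f k)) \<le> (\<Sum>k<n. ennreal (norm (f k)))"
      by (simp add: sum_ennreal ennreal_leI norm_sum)
    also have "\<dots> \<le> (\<Sum>k. ennreal (norm (f k)))"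
      by (intro sum_le_suminf) auto
    finally show ?thesis .
  qed
  then show "\<exists>N. \<forall>n\<ge>N. ennreal (norm (\<Sum>k<n. f k)) \<le> (\<Sum>k. ennreal (norm (f k)))"
    by blast
qed

text \<open>One of the two sums is read as an integral against counting measure, so this is monotone
  convergence for nonnegative series.\<close>

lemma suminf_swap_ennreal:
  fixes f :: "nat \<Rightarrow> nat \<Rightarrow> ennreal"
  shows "(\<Sum>i. \<Sum>j. f i j) = (\<Sum>j. \<Sum>i. f i j)"
  using nn_integral_suminf[of f "count_space UNIV"] by (simp add: nn_integral_count_space_nat)

text \<open>A partition of \<open>A\<close> placed at the even indices and one of \<open>B\<close>
  at the odd indices form a partition of the union, and the norm sums add up. Partitions exist for
  both sets, which allows the two suprema to be merged into one.\<close>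

lemma total_variation_superadditive:
  assumes A: "A \<in> sets M" and B: "B \<in> sets M" and AB: "A \<inter> B = {}"
  shows "total_variation M \<nu> A + total_variation M \<nu> B \<le> total_variation M \<nu> (A \<union> B)"
proof -
  let ?P = "\<lambda>B. {E :: nat \<Rightarrow> _. range E \<subseteq> sets M \<and> disjoint_family E \<and> (\<Union>k. E k) = B}"
  let ?n = "\<lambda>E. \<Sum>k. ennreal (norm (\<nu> (E k)))"
  have ne: "?P B \<noteq> {}" if "B \<in> sets M" for B
  proof -
    have "binaryset B {} \<in> ?P B"
      using that by (auto simp: disjoint_family_on_def binaryset_def split: if_splits)
    then show ?thesis by blast
  qed
  have key: "?n E + ?n F \<le> total_variation M \<nu> (A \<union> B)" if E: "E \<in> ?P A" and F: "F \<in> ?P B" for E F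
  proof -
    define G where "G k = (if even k then E (k div 2) else F (k div 2))" for k :: nat
    have "range G \<subseteq> sets M"
      using E F by (auto simp: G_def)
    moreover have "disjoint_family G"
      unfolding disjoint_family_on_def
    proof (intro ballI impI)
      fix m n :: nat assume "m \<noteq> n"
      have "E i \<subseteq> A" "F i \<subseteq> B" for i
        using E F by auto
      then have "E i \<inter> F j = {}" for i j
        using AB by blast
      moreover have "m div 2 \<noteq> n div 2" if "even m = even n"
        using that \<open>m \<noteq> n\<close> by (metis even_two_times_div_two odd_two_times_div_two_succ)
      ultimately show "G m \<inter> G n = {}"
        using E F by (auto simp: G_def disjoint_family_on_def Int_commute)
    qed
    moreover have "(\<Union>k. G k) = A \<union> B"
    proof -
      have "E k = G (2 * k)" "F k = G (2 * k + 1)" for k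
        by (simp_all add: G_def)
      then have "E k \<subseteq> (\<Union>k. G k)" "F k \<subseteq> (\<Union>k. G k)" for k
        by blast+
      then have "A \<union> B \<subseteq> (\<Union>k. G k)"
        using E F by (metis (mono_tags, lifting) UN_least Un_least mem_Collect_eq)
      moreover have "(\<Union>k. G k) \<subseteq> A \<union> B"
        using E F by (auto simp: G_def split: if_splits)
      ultimately show ?thesis by blast
    qed
    ultimately have "?n G \<le> total_variation M \<nu> (A \<union> B)"
      by (rule suminf_le_total_variation)
    moreover have "?n E + ?n F \<le> ?n G"
    proof -
      have "(\<Sum>k<n. ennreal (norm (\<nu> (E k))) + ennreal (norm (\<nu> (F k)))) \<le> ?n G" for n
      proof -
        have "(\<Sum>k<n. ennreal (norm (\<nu> (E k))) + ennreal (norm (\<nu> (F k))))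
            = (\<Sum>k<2 * n. ennreal (norm (\<nu> (G k))))"
          by (induction n) (auto simp: G_def ac_simps)
        also have "\<dots> \<le> ?n G"
          by (intro sum_le_suminf) auto
        finally show ?thesis .
      qed
      then have "(\<Sum>k. ennreal (norm (\<nu> (E k))) + ennreal (norm (\<nu> (F k)))) \<le> ?n G"
        by (intro suminf_le_const) auto
      then show ?thesis
        by (simp add: suminf_add[symmetric])
    qed
    ultimately show ?thesis
      by (rule order_trans[rotated])
  qed
  have "total_variation M \<nu> A + total_variation M \<nu> B = (SUP E\<in>?P A. SUP F\<in>?P B. ?n E + ?n F)"
    unfolding total_variation_def ennreal_SUP_add_left[OF ne[OF A], symmetric]
    by (subst ennreal_SUP_add_right[OF ne[OF B]]) (rule refl)
  also have "\<dots> \<le> total_variation M \<nu> (A \<union> B)"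
    using key by (intro SUP_least)
  finally show ?thesis .
qed

text \<open>Superadditivity bounds every partial sum and gives one inequality. For the other, a
  partition \<open>E\<close> of the union is refined by the sets \<open>A i\<close>: additivity of
  \<nu> bounds the norm on \<open>E k\<close> by the sum of the norms on
  \<open>E k \<inter> A i\<close>, and after exchanging the sums the pieces for fixed
  \<open>i\<close> partition \<open>A i\<close>.\<close>

lemma countably_additive_total_variation:
  assumes \<nu>: "vector_measure M \<nu>"
  shows "countably_additive (sets M) (total_variation M \<nu>)"
  unfolding countably_additive_def
proof (intro allI impI)
  fix A :: "nat \<Rightarrow> _" assume A: "range A \<subseteq> sets M" "disjoint_family A" "(\<Union>i. A i) \<in> sets M"
  have [measurable]: "A i \<in> sets M" for i
    using A by auto
  show "(\<Sum>i. total_variation M \<nu> (A i)) = total_variation M \<nu> (\<Union>i. A i)"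
  proof (rule antisym)
    have fin: "(\<Sum>i<n. total_variation M \<nu> (A i)) \<le> total_variation M \<nu> (\<Union>i<n. A i)" for n
    proof (induction n)
      case (Suc n)
      have "(\<Union>i<n. A i) \<inter> A n = {}"
        using A(2) disjoint_family_onD[of A UNIV _ n] by fastforce
      then have "total_variation M \<nu> (\<Union>i<n. A i) + total_variation M \<nu> (A n) \<le> total_variation M \<nu> ((\<Union>i<n. A i) \<union> A n)"
        by (intro total_variation_superadditive) auto
      with Suc show ?case
        by (simp add: lessThan_Suc Un_commute add.commute) (meson add_right_mono order_trans add_mono order_refl)
    qed simp
    have mono: "total_variation M \<nu> (\<Union>i<n. A i) \<le> total_variation M \<nu> (\<Union>i. A i)" for n
    proof -
      have "(\<Union>i<n. A i) \<union> ((\<Union>i. A i) - (\<Union>i<n. A i)) = (\<Union>i. A i)"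
        by blast
      then show ?thesis
        using total_variation_superadditive[of "\<Union>i<n. A i" M "(\<Union>i. A i) - (\<Union>i<n. A i)" \<nu>]
        by (auto intro: order_trans[rotated] le_add_same_cancel1[THEN iffD2])
    qed
    show "(\<Sum>i. total_variation M \<nu> (A i)) \<le> total_variation M \<nu> (\<Union>i. A i)"
      using order_trans[OF fin mono] by (intro suminf_le_const) auto
    show "total_variation M \<nu> (\<Union>i. A i) \<le> (\<Sum>i. total_variation M \<nu> (A i))"
    proof (rule total_variation_bounded)
      fix E :: "nat \<Rightarrow> _" assume E: "range E \<subseteq> sets M" "disjoint_family E" "(\<Union>k. E k) = (\<Union>i. A i)"
      have [measurable]: "E i \<in> sets M" for i
        using E by auto
      have "ennreal (norm (\<nu> (E k))) \<le> (\<Sum>i. ennreal (norm (\<nu> (E k \<inter> A i))))" for k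
      proof (rule norm_sums_le_suminf_ennreal)
        have "(\<lambda>i. \<nu> (E k \<inter> A i)) sums \<nu> (\<Union>i. E k \<inter> A i)"
          using A(2) by (intro vector_measure_sums[OF \<nu>]) (auto simp: disjoint_family_on_def)
        moreover have "(\<Union>i. E k \<inter> A i) = E k"
          using E(3) by blast
        ultimately show "(\<lambda>i. \<nu> (E k \<inter> A i)) sums \<nu> (E k)"
          by simp
      qed
      then have "(\<Sum>k. ennreal (norm (\<nu> (E k)))) \<le> (\<Sum>k. \<Sum>i. ennreal (norm (\<nu> (E k \<inter> A i))))"
        by (intro suminf_le) auto
      also have "\<dots> = (\<Sum>i. \<Sum>k. ennreal (norm (\<nu> (E k \<inter> A i))))"
        by (rule suminf_swap_ennreal)
      also have "\<dots> \<le> (\<Sum>i. total_variation M \<nu> (A i))"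
      proof (intro suminf_le)
        fix i
        show "(\<Sum>k. ennreal (norm (\<nu> (E k \<inter> A i)))) \<le> total_variation M \<nu> (A i)"
        proof (rule suminf_le_total_variation)
          show "disjoint_family (\<lambda>k. E k \<inter> A i)"
            using E(2) by (auto simp: disjoint_family_on_def)
          show "(\<Union>k. E k \<inter> A i) = A i"
            using E(3) by blast
        qed auto
      qed auto
      finally show "(\<Sum>k. ennreal (norm (\<nu> (E k)))) \<le> (\<Sum>i. total_variation M \<nu> (A i))" .
    qed
  qed
qed

definition variation_measure :: "'a measure \<Rightarrow> ('a set \<Rightarrow> 'b::real_normed_vector) \<Rightarrow> 'a measure" where
  "variation_measure M \<nu> = measure_of (space M) (sets M) (total_variation M \<nu>)"

lemma sets_variation_measure [simp, measurable_cong]: "sets (variation_measure M \<nu>) = sets M"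
  and space_variation_measure [simp]: "space (variation_measure M \<nu>) = space M"
  by (simp_all add: variation_measure_def)

lemma total_variation_empty:
  assumes "vector_measure M \<nu>"
  shows "total_variation M \<nu> {} = 0"
proof -
  have "total_variation M \<nu> {} \<le> 0"
    by (rule total_variation_bounded) (auto simp: vector_measure_empty[OF assms])
  then show ?thesis by simp
qed

lemma emeasure_variation_measure:
  assumes "vector_measure M \<nu>" "B \<in> sets M"
  shows "emeasure (variation_measure M \<nu>) B = total_variation M \<nu> B"
  using assms total_variation_empty[OF assms(1)] countably_additive_total_variation[OF assms(1)]
  by (intro emeasure_measure_of[OF variation_measure_def])
    (auto simp: sets.space_closed positive_def)

lemma finite_variation_measure:
  assumes "vector_measure M \<nu>" "total_variation M \<nu> (space M) < \<infinity>"
  shows "finite_measure (variation_measure M \<nu>)"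
  by (rule finite_measureI) (use assms in \<open>simp add: emeasure_variation_measure\<close>)

lemma norm_le_measure_variation_measure:
  assumes "vector_measure M \<nu>" "total_variation M \<nu> (space M) < \<infinity>" "B \<in> sets M"
  shows "norm (\<nu> B) \<le> measure (variation_measure M \<nu>) B"
proof -
  interpret finite_measure "variation_measure M \<nu>"
    by (rule finite_variation_measure[OF assms(1,2)])
  show ?thesis
    using norm_le_total_variation[OF assms(1,3)]
    by (simp add: emeasure_variation_measure[OF assms(1,3), symmetric] emeasure_eq_measure)
qed

section \<open>Jordan decomposition and the signed integral\<close>

text \<open>Since the norm of \<nu>(B) is at most the variation of B, half the sum of variation and
  \<nu> is nonnegative. Additivity is therefore proved for real series, where cancellation is
  harmless, and only then carried over to \<open>ennreal\<close>.\<close>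

lemma
  fixes \<nu> :: "'a set \<Rightarrow> real"
  assumes \<nu>: "vector_measure M \<nu>" and fin: "total_variation M \<nu> (space M) < \<infinity>"
  shows finite_measure_positive_part: "finite_measure (positive_part M \<nu>)"
    and measure_positive_part:
      "B \<in> sets M \<Longrightarrow> measure (positive_part M \<nu>) B = (measure (variation_measure M \<nu>) B + \<nu> B) / 2"
    and sets_positive_part: "sets (positive_part M \<nu>) = sets M"
proof -
  let ?V = "variation_measure M \<nu>"
  interpret V: finite_measure ?V
    by (rule finite_variation_measure[OF \<nu> fin])
  have nonneg: "0 \<le> measure ?V B + \<nu> B" if "B \<in> sets M" for B
    using norm_le_measure_variation_measure[OF \<nu> fin that] by auto
  show sets: "sets (positive_part M \<nu>) = sets M"
    by (simp add: positive_part_def)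
  have tv: "enn2real (total_variation M \<nu> B) = measure ?V B" if "B \<in> sets M" for B
    using that by (simp add: emeasure_variation_measure[OF \<nu>, symmetric] measure_def)
  have em: "emeasure (positive_part M \<nu>) B = ennreal ((measure ?V B + \<nu> B) / 2)" if "B \<in> sets M" for B
  proof -
    have "emeasure (positive_part M \<nu>) B = ennreal ((enn2real (total_variation M \<nu> B) + \<nu> B) / 2)"
    proof (rule emeasure_measure_of[OF positive_part_def])
      show "positive (sets (positive_part M \<nu>)) (\<lambda>B. ennreal ((enn2real (total_variation M \<nu> B) + \<nu> B) / 2))"
        by (simp add: positive_def total_variation_empty[OF \<nu>] vector_measure_empty[OF \<nu>])
      show "countably_additive (sets (positive_part M \<nu>)) (\<lambda>B. ennreal ((enn2real (total_variation M \<nu> B) + \<nu> B) / 2))"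
        unfolding countably_additive_def sets
      proof (intro allI impI)
        fix A :: "nat \<Rightarrow> _" assume A: "range A \<subseteq> sets M" "disjoint_family A" "(\<Union>i. A i) \<in> sets M"
        have "(\<lambda>i. (measure ?V (A i) + \<nu> (A i)) / 2) sums ((measure ?V (\<Union>i. A i) + \<nu> (\<Union>i. A i)) / 2)"
          using A by (intro sums_divide sums_add V.finite_measure_UNION vector_measure_sums[OF \<nu>]) auto
        then show "(\<Sum>i. ennreal ((enn2real (total_variation M \<nu> (A i)) + \<nu> (A i)) / 2)) =
            ennreal ((enn2real (total_variation M \<nu> (\<Union>i. A i)) + \<nu> (\<Union>i. A i)) / 2)"
          using A tv nonneg by (intro suminf_ennreal_eq) (auto simp: image_subset_iff)
      qed
    qed (use that sets sets.space_closed in auto)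
    then show ?thesis
      using tv that by simp
  qed
  show "finite_measure (positive_part M \<nu>)"
    by (rule finite_measureI) (simp add: em sets_eq_imp_space_eq[OF sets])
  show "measure (positive_part M \<nu>) B = (measure ?V B + \<nu> B) / 2" if "B \<in> sets M"
    using em[OF that] nonneg[OF that] by (simp add: measure_def)
qed

lemma total_variation_uminus: "total_variation M (\<lambda>B. - \<nu> B) = total_variation M \<nu>"
  by (simp add: total_variation_def fun_eq_iff)

lemma variation_measure_uminus: "variation_measure M (\<lambda>B. - \<nu> B) = variation_measure M \<nu>"
  by (simp add: variation_measure_def total_variation_uminus)

lemma vector_measure_uminus: "vector_measure M \<nu> \<Longrightarrow> vector_measure M (\<lambda>B. - \<nu> B)"
  by (simp add: vector_measure_def sums_minus)



text \<open>An identity between differences of measures is stated with sums on both sides, because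
  subtraction in \<open>ennreal\<close> truncates and is undone by infinite values. In this form it
  passes through the usual induction over nonnegative measurable functions.\<close>

lemma nn_integral_add_measure_cong:
  assumes fin: "finite_measure P" "finite_measure Q" "finite_measure R" "finite_measure S"
    and sets: "sets P = sets M" "sets Q = sets M" "sets R = sets M" "sets S = sets M"
    and eq: "\<And>B. B \<in> sets M \<Longrightarrow> measure P B + measure Q B = measure R B + measure S B"
    and f: "f \<in> borel_measurable M"
  shows "(\<integral>\<^sup>+x. f x \<partial>P) + (\<integral>\<^sup>+x. f x \<partial>Q) = (\<integral>\<^sup>+x. f x \<partial>R) + (\<integral>\<^sup>+x. f x \<partial>S)"
proof -
  note [measurable_cong] = sets
  note space = sets_eq_imp_space_eq[OF sets(1)] sets_eq_imp_space_eq[OF sets(2)]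
    sets_eq_imp_space_eq[OF sets(3)] sets_eq_imp_space_eq[OF sets(4)]
  show ?thesis
    using f
  proof (induction rule: borel_measurable_induct)
    case (cong f g)
    then have "integral\<^sup>N N f = integral\<^sup>N N g" if "space N = space M" for N
      using that by (intro nn_integral_cong) auto
    then show ?case
      using cong space by simp
  next
    case (set A)
    then show ?case
      using eq[OF set] fin sets
      by (simp add: finite_measure.emeasure_eq_measure flip: ennreal_plus)
  next
    case (mult u c)
    then show ?case
      by (simp add: nn_integral_cmult flip: distrib_left)
  next
    case (add u v)
    then show ?case
      by (simp add: nn_integral_add) (metis (no_types, opaque_lifting) add.assoc add.left_commute)
  next
    case (seq U)
    note [measurable] = seq(1)
    have "(\<integral>\<^sup>+x. (SUP i. U i) x \<partial>N) + (\<integral>\<^sup>+x. (SUP i. U i) x \<partial>N') = (SUP i. integral\<^sup>N N (U i) + integral\<^sup>N N' (U i))"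
      if N [measurable_cong]: "sets N = sets M" "sets N' = sets M" for N N'
    proof -
      have "incseq (\<lambda>i. integral\<^sup>N N (U i))" for N
        using \<open>incseq U\<close> by (auto simp: mono_def le_fun_def intro!: nn_integral_mono)
      moreover have "U i \<in> borel_measurable N" "U i \<in> borel_measurable N'" for i
        by measurable
      ultimately show ?thesis
        using \<open>incseq U\<close> by (simp add: image_comp nn_integral_monotone_convergence_SUP ennreal_SUP_add)
    qed
    then show ?case
      using seq.IH sets by simp
  qed
qed

lemma integrable_bounded_finite_measure:
  fixes f :: "'a \<Rightarrow> real"
  assumes "finite_measure N" "sets N = sets M" "f \<in> borel_measurable M" "\<And>x. \<bar>f x\<bar> \<le> C"
  shows "integrable N f"
  using assms measurable_cong_sets[OF assms(2) refl, of borel]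
  by (intro finite_measure.integrable_const_bound[of N f C]) auto

lemma integral_add_measure_cong:
  fixes f :: "'a \<Rightarrow> real"
  assumes fin: "finite_measure P" "finite_measure Q" "finite_measure R" "finite_measure S"
    and sets: "sets P = sets M" "sets Q = sets M" "sets R = sets M" "sets S = sets M"
    and eq: "\<And>B. B \<in> sets M \<Longrightarrow> measure P B + measure Q B = measure R B + measure S B"
    and f: "f \<in> borel_measurable M" "\<And>x. \<bar>f x\<bar> \<le> C"
  shows "integral\<^sup>L P f + integral\<^sup>L Q f = integral\<^sup>L R f + integral\<^sup>L S f"
proof -
  have I: "integrable N f" if "finite_measure N" "sets N = sets M" for N
    using integrable_bounded_finite_measure[OF that f] .
  have *: "enn2real (\<integral>\<^sup>+x. g x \<partial>P) + enn2real (\<integral>\<^sup>+x. g x \<partial>Q) = enn2real (\<integral>\<^sup>+x. g x \<partial>R) + enn2real (\<integral>\<^sup>+x. g x \<partial>S)"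
    if "g = f \<or> g = (\<lambda>x. - f x)" for g
  proof -
    have lt: "(\<integral>\<^sup>+x. ennreal (g x) \<partial>N) < top" if "finite_measure N" "sets N = sets M" for N
      using I[OF that] \<open>g = f \<or> _\<close> by (auto simp: real_integrable_def less_top)
    have "(\<lambda>x. ennreal (g x)) \<in> borel_measurable M"
      using that f(1) by auto
    from nn_integral_add_measure_cong[OF fin sets eq this] show ?thesis
      using lt fin sets by (metis enn2real_plus)
  qed
  show ?thesis
    using *[of f] *[of "\<lambda>x. - f x"] I fin sets by (simp add: real_lebesgue_integral_def)
qed

text \<open>If \<nu> is \<open>P\<close> minus \<open>N\<close> as well as the difference of its
  Jordan parts, then the positive part plus \<open>N\<close> equals \<open>P\<close> plus the
  negative part, an identity of positive measures that integrates. Thus any difference of finite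
  measures computes the integral, in particular \<lambda> - \<nu>\<open>\<^sub>e\<close>.\<close>

lemma signed_integral_eq:
  fixes f :: "'a \<Rightarrow> real"
  assumes \<nu>: "vector_measure M \<nu>" and fin: "total_variation M \<nu> (space M) < \<infinity>"
    and PN: "finite_measure P" "finite_measure N" "sets P = sets M" "sets N = sets M"
    and eq: "\<And>B. B \<in> sets M \<Longrightarrow> \<nu> B = measure P B - measure N B"
    and f: "f \<in> borel_measurable M" "\<And>x. \<bar>f x\<bar> \<le> C"
  shows "signed_integral M \<nu> f = integral\<^sup>L P f - integral\<^sup>L N f"
proof -
  note \<nu>' = vector_measure_uminus[OF \<nu>]
  have fin': "total_variation M (\<lambda>B. - \<nu> B) (space M) < \<infinity>"
    using fin by (simp add: total_variation_uminus)
  have "integral\<^sup>L (positive_part M \<nu>) f + integral\<^sup>L N f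
      = integral\<^sup>L P f + integral\<^sup>L (positive_part M (\<lambda>B. - \<nu> B)) f"
  proof (rule integral_add_measure_cong)
    show "measure (positive_part M \<nu>) B + measure N B = measure P B + measure (positive_part M (\<lambda>B. - \<nu> B)) B"
      if "B \<in> sets M" for B
      using that eq[OF that]
      by (simp add: measure_positive_part[OF \<nu> fin] measure_positive_part[OF \<nu>' fin'] variation_measure_uminus field_simps)
  qed (use PN f in \<open>auto simp: sets_positive_part[OF \<nu> fin] sets_positive_part[OF \<nu>' fin']
      finite_measure_positive_part[OF \<nu> fin] finite_measure_positive_part[OF \<nu>' fin']\<close>)
  then show ?thesis
    by (simp add: signed_integral_def)
qed

text \<open>Provides finite positive measures to which dominated convergence applies. Off
  \<open>sets M\<close> all terms are 0, so the decomposition holds for every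
  \<open>B\<close>.\<close>

lemma signed_integral_Jordan:
  fixes \<nu> :: "'a set \<Rightarrow> real"
  assumes \<nu>: "vector_measure M \<nu>" and fin: "total_variation M \<nu> (space M) < \<infinity>"
  obtains P N where "finite_measure P" "finite_measure N" "sets P = sets M" "sets N = sets M"
    "\<And>B. \<nu> B = measure P B - measure N B" "\<And>f. signed_integral M \<nu> f = integral\<^sup>L P f - integral\<^sup>L N f"
proof
  note \<nu>' = vector_measure_uminus[OF \<nu>]
  have fin': "total_variation M (\<lambda>B. - \<nu> B) (space M) < \<infinity>"
    using fin by (simp add: total_variation_uminus)
  show "finite_measure (positive_part M \<nu>)" "finite_measure (positive_part M (\<lambda>B. - \<nu> B))"
    "sets (positive_part M \<nu>) = sets M" "sets (positive_part M (\<lambda>B. - \<nu> B)) = sets M"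
    using finite_measure_positive_part sets_positive_part \<nu> fin \<nu>' fin' by blast+
  then show "\<nu> B = measure (positive_part M \<nu>) B - measure (positive_part M (\<lambda>B. - \<nu> B)) B" for B
    using measure_positive_part[OF \<nu> fin, of B] measure_positive_part[OF \<nu>' fin', of B]
    by (cases "B \<in> sets M") (auto simp: variation_measure_uminus measure_notin_sets vector_measure_notin[OF \<nu>] field_simps)
qed (simp add: signed_integral_def)


section \<open>Riesz representation on test functions\<close>

lemma ennreal_add_le: "ennreal (a + b) \<le> ennreal a + ennreal b"
  by (auto simp: ennreal_plus_if intro!: ennreal_leI)

text \<open>Because \<Omega> is open, its relatively open subsets are the open sets contained in it:
  an intersection-stable generator whose members are limits of test functions.\<close>

lemma sets_restrict_borel_open:
  fixes \<Omega> :: "'a::topological_space set"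
  assumes "open \<Omega>"
  shows "sets (restrict_space borel \<Omega>) = sigma_sets \<Omega> {V. open V \<and> V \<subseteq> \<Omega>}"
proof -
  have "sets (restrict_space borel \<Omega>) = (\<inter>) \<Omega> ` sigma_sets UNIV {V. open V}"
    by (simp add: sets_restrict_space borel_def)
  also have "\<dots> = sigma_sets \<Omega> ((\<inter>) \<Omega> ` {V. open V})"
    using assms by (intro sigma_sets_Int) auto
  also have "(\<inter>) \<Omega> ` {V. open V} = {V. open V \<and> V \<subseteq> \<Omega>}"
    using assms by (auto simp: image_iff)
  finally show ?thesis .
qed

lemma open_in_sets_restrict_borel:
  "open V \<Longrightarrow> V \<subseteq> \<Omega> \<Longrightarrow> V \<in> sets (restrict_space borel \<Omega>)"
  by (auto simp: sets_restrict_space image_iff intro!: exI[of _ V])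

lemma Cc_infinity_measurable:
  assumes "sets N = sets (restrict_space borel S)" "\<phi> \<in> Cc_infinity \<Omega>"
  shows "\<phi> \<in> borel_measurable N"
proof -
  have "\<phi> \<in> borel_measurable (restrict_space borel S)"
    using assms(2)
    by (intro measurable_restrict_space1 borel_measurable_continuous_onI Cc_infinity_continuous)
  then show ?thesis
    by (simp add: measurable_cong_sets[OF assms(1) refl])
qed

lemma Cc_infinity_integrable:
  fixes \<phi> :: "real^'n::finite \<Rightarrow> real"
  assumes "finite_measure N" "sets N = sets (restrict_space borel S)" "\<phi> \<in> Cc_infinity \<Omega>"
  shows "integrable N \<phi>"
proof -
  obtain B where "\<And>x. norm (\<phi> x) \<le> B"
    using Cc_infinity_bounded[OF assms(3)] by blast
  then show ?thesis
    by (intro finite_measure.integrable_const_bound[OF assms(1), of _ B] Cc_infinity_measurable[OF assms(2,3)])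
      simp
qed

section \<open>The variation of a bounded functional on test functions\<close>

text \<open>The value space is arbitrary because the construction is run twice: for the
  vector-valued functional itself and for the scalar positive functionals derived from it. The
  one-sided bound is symmetric by linearity.\<close>

locale test_functional =
  fixes \<Omega> :: "(real^'n::finite) set" and L :: "(real^'n \<Rightarrow> 'b::real_normed_vector) \<Rightarrow> real" and C :: real
  assumes open_domain: "open \<Omega>"
    and L_add: "\<phi> \<in> Cc_infinity \<Omega> \<Longrightarrow> \<psi> \<in> Cc_infinity \<Omega> \<Longrightarrow> L (\<lambda>x. \<phi> x + \<psi> x) = L \<phi> + L \<psi>"
    and L_scaleR: "\<phi> \<in> Cc_infinity \<Omega> \<Longrightarrow> L (\<lambda>x. c *\<^sub>R \<phi> x) = c * L \<phi>"
    and L_bound: "\<phi> \<in> Cc_infinity \<Omega> \<Longrightarrow> (\<And>x. norm (\<phi> x) \<le> 1) \<Longrightarrow> L \<phi> \<le> C"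
begin

lemma L_zero: "L (\<lambda>x. 0) = 0"
  using L_scaleR[OF Cc_infinity_zero, of 0] by simp

lemma L_diff:
  assumes "\<phi> \<in> Cc_infinity \<Omega>" "\<psi> \<in> Cc_infinity \<Omega>"
  shows "L (\<lambda>x. \<phi> x - \<psi> x) = L \<phi> - L \<psi>"
  using L_add[OF assms(1) Cc_infinity_scaleR[OF assms(2), of "-1"]] L_scaleR[OF assms(2), of "-1"] by simp

lemma L_sum:
  assumes "\<And>i. i \<in> I \<Longrightarrow> \<phi> i \<in> Cc_infinity \<Omega>"
  shows "L (\<lambda>x. \<Sum>i\<in>I. \<phi> i x) = (\<Sum>i\<in>I. L (\<phi> i))"
  using assms
proof (induction I rule: infinite_finite_induct)
  case (insert i I)
  then show ?case
    using L_add[of "\<phi> i" "\<lambda>x. \<Sum>i\<in>I. \<phi> i x"] by (simp add: Cc_infinity_sum)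
qed (auto simp: L_zero)

text \<open>\<open>ennreal\<close> replaces negative values by 0; this does not change the supremum,
  as the zero field is admissible.\<close>

definition open_variation :: "(real^'n) set \<Rightarrow> ennreal" where
  "open_variation V = (SUP \<phi>\<in>{\<phi> \<in> Cc_infinity V. \<forall>x. norm (\<phi> x) \<le> 1}. ennreal (L \<phi>))"

lemma open_variation_upper:
  "\<phi> \<in> Cc_infinity V \<Longrightarrow> (\<And>x. norm (\<phi> x) \<le> 1) \<Longrightarrow> ennreal (L \<phi>) \<le> open_variation V"
  unfolding open_variation_def by (intro SUP_upper) auto

lemma open_variation_mono: "V \<subseteq> W \<Longrightarrow> open_variation V \<le> open_variation W"
  unfolding open_variation_def by (intro SUP_subset_mono) (auto intro: Cc_infinity_mono)

lemma open_variation_finite: "V \<subseteq> \<Omega> \<Longrightarrow> open_variation V < top"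
proof -
  assume "V \<subseteq> \<Omega>"
  have "open_variation V \<le> ennreal C"
    unfolding open_variation_def
    by (intro SUP_least ennreal_leI) (auto intro: L_bound Cc_infinity_mono[OF _ \<open>V \<subseteq> \<Omega>\<close>])
  then show ?thesis
    using ennreal_less_top le_less_trans by blast
qed

lemma open_variation_empty: "open_variation {} = 0"
proof -
  have "L \<phi> = 0" if "\<phi> \<in> Cc_infinity {}" for \<phi>
  proof -
    have "\<phi> = (\<lambda>x. 0)"
      using Cc_infinity_vanish[OF that] by auto
    then show ?thesis
      by (simp add: L_zero)
  qed
  then show ?thesis
    unfolding open_variation_def by (intro antisym SUP_least) auto
qed

lemma L_le_open_variation:
  assumes "\<phi> \<in> Cc_infinity V" "V \<subseteq> \<Omega>" "M \<ge> 0" "\<And>x. norm (\<phi> x) \<le> M"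
  shows "ennreal (L \<phi>) \<le> ennreal M * open_variation V"
proof (cases "M = 0")
  case True
  then have "\<phi> = (\<lambda>x. 0)"
    using assms by auto
  then show ?thesis
    by (simp add: L_zero)
next
  case False
  have "L \<phi> = M * L (\<lambda>x. (1 / M) *\<^sub>R \<phi> x)"
    using False L_scaleR[OF Cc_infinity_mono[OF assms(1,2)], of "1 / M"] by simp
  moreover have "ennreal (L (\<lambda>x. (1 / M) *\<^sub>R \<phi> x)) \<le> open_variation V"
    using assms False by (intro open_variation_upper Cc_infinity_scaleR) (auto simp: field_simps)
  ultimately show ?thesis
    using assms(3) by (simp add: ennreal_mult' mult_left_mono)
qed

text \<open>By induction on \<open>J\<close>, a piece supported in \<open>V j\<close> is split off
  without increasing the norm anywhere. The individual bounds \<open>M j\<close> serve two purposes: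
  all equal to 1 they give subadditivity, and as levels of the norm of \<phi> they give an upper sum
  for its integral.\<close>

lemma L_le_sum_open_variation:
  assumes "finite J" "\<And>j. j \<in> J \<Longrightarrow> open (V j)" "\<And>j. j \<in> J \<Longrightarrow> V j \<subseteq> \<Omega>" "\<And>j. j \<in> J \<Longrightarrow> M j \<ge> 0"
    and "\<phi> \<in> Cc_infinity (\<Union>j\<in>J. V j)" "\<And>j x. j \<in> J \<Longrightarrow> x \<in> V j \<Longrightarrow> norm (\<phi> x) \<le> M j"
  shows "ennreal (L \<phi>) \<le> (\<Sum>j\<in>J. ennreal (M j) * open_variation (V j))"
  using assms
proof (induction J arbitrary: \<phi> rule: finite_induct)
  case empty
  then have "\<phi> = (\<lambda>x. 0)"
    using Cc_infinity_vanish[of \<phi> "{}"] by auto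
  then show ?case
    by (simp add: L_zero)
next
  case (insert j J)
  obtain \<phi>1 \<phi>2 where \<phi>: "\<phi>1 \<in> Cc_infinity (V j)" "\<phi>2 \<in> Cc_infinity (\<Union>j\<in>J. V j)" "\<phi> = (\<lambda>x. \<phi>1 x + \<phi>2 x)"
    "\<And>x. norm (\<phi>1 x) \<le> norm (\<phi> x)" "\<And>x. norm (\<phi>2 x) \<le> norm (\<phi> x)"
  proof (rule Cc_infinity_split[of \<phi> "V j" "\<Union>j\<in>J. V j"])
    show "\<phi> \<in> Cc_infinity (V j \<union> (\<Union>j\<in>J. V j))" "open (V j)" "open (\<Union>j\<in>J. V j)"
      using insert.prems by auto
  qed blast
  have "L \<phi> = L \<phi>1 + L \<phi>2"
    unfolding \<phi>(3) using insert.prems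
    by (intro L_add Cc_infinity_mono[OF \<phi>(1)] Cc_infinity_mono[OF \<phi>(2)]) auto
  then have "ennreal (L \<phi>) \<le> ennreal (L \<phi>1) + ennreal (L \<phi>2)"
    by (simp add: ennreal_add_le)
  also have "ennreal (L \<phi>1) \<le> ennreal (M j) * open_variation (V j)"
  proof (rule L_le_open_variation[OF \<phi>(1)])
    show "norm (\<phi>1 x) \<le> M j" for x
    proof (cases "x \<in> V j")
      case True
      then show ?thesis
        using insert.prems(5)[of j x] \<phi>(4)[of x] by simp
    next
      case False
      then show ?thesis
        using Cc_infinity_vanish[OF \<phi>(1)] insert.prems(3)[of j] by simp
    qed
  qed (use insert.prems in auto)
  also have "ennreal (L \<phi>2) \<le> (\<Sum>j\<in>J. ennreal (M j) * open_variation (V j))"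
  proof (rule insert.IH[OF _ _ _ \<phi>(2)])
    show "norm (\<phi>2 x) \<le> M i" if "i \<in> J" "x \<in> V i" for i x
      using insert.prems(5)[of i x] \<phi>(5)[of x] that by simp
  qed (use insert.prems in auto)
  finally show ?case
    using insert.hyps by (simp add: add_mono)
qed

text \<open>A competitor has compact support, which already lies in finitely many of the sets, so
  the finite estimate applies.\<close>

lemma open_variation_UN:
  assumes "\<And>i. open (V i)" "\<And>i. V i \<subseteq> \<Omega>"
  shows "open_variation (\<Union>i::nat. V i) \<le> (\<Sum>i. open_variation (V i))"
  unfolding open_variation_def[of "\<Union>i. V i"]
proof (rule SUP_least)
  fix \<phi> :: "real^'n \<Rightarrow> 'b" assume "\<phi> \<in> {\<phi> \<in> Cc_infinity (\<Union>i. V i). \<forall>x. norm (\<phi> x) \<le> 1}"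
  then have \<phi>: "\<phi> \<in> Cc_infinity (\<Union>i. V i)" "\<And>x. norm (\<phi> x) \<le> 1"
    by auto
  obtain K where K: "compact K" "K \<subseteq> (\<Union>i. V i)" "\<And>x. x \<notin> K \<Longrightarrow> \<phi> x = 0"
    using Cc_infinityE[OF \<phi>(1)] by blast
  obtain J where J: "finite J" "K \<subseteq> (\<Union>i\<in>J. V i)"
    using compactE_image[OF K(1), of UNIV V] assms(1) K(2) by auto
  have "\<phi> \<in> Cc_infinity (\<Union>i\<in>J. V i)"
    by (rule Cc_infinityI[OF Cc_infinity_C_k[OF \<phi>(1)] K(1) J(2) K(3)])
  then have "ennreal (L \<phi>) \<le> (\<Sum>i\<in>J. ennreal 1 * open_variation (V i))"
    using J assms \<phi>(2) by (intro L_le_sum_open_variation) auto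
  also have "\<dots> \<le> (\<Sum>i. open_variation (V i))"
    using J by (simp add: sum_le_suminf)
  finally show "ennreal (L \<phi>) \<le> (\<Sum>i. open_variation (V i))" .
qed

text \<open>Outer regularity is imposed by definition. A set not contained in \<Omega> gets the
  value \<open>top\<close>, the infimum being over the empty family; the outer measure lives on
  \<open>Pow \<Omega>\<close>.\<close>

definition outer_variation :: "(real^'n) set \<Rightarrow> ennreal" where
  "outer_variation E = (INF V\<in>{V. open V \<and> E \<subseteq> V \<and> V \<subseteq> \<Omega>}. open_variation V)"

lemma outer_variation_lower:
  "open V \<Longrightarrow> E \<subseteq> V \<Longrightarrow> V \<subseteq> \<Omega> \<Longrightarrow> outer_variation E \<le> open_variation V"
  unfolding outer_variation_def by (intro INF_lower) auto

lemma outer_variation_open: "open V \<Longrightarrow> V \<subseteq> \<Omega> \<Longrightarrow> outer_variation V = open_variation V"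
  by (intro antisym outer_variation_lower)
    (auto simp: outer_variation_def intro!: INF_greatest open_variation_mono)

lemma outer_variation_mono: "E \<subseteq> F \<Longrightarrow> outer_variation E \<le> outer_variation F"
  unfolding outer_variation_def by (intro INF_superset_mono) auto

lemma outer_variation_approx:
  assumes "E \<subseteq> \<Omega>" "e > 0"
  obtains V where "open V" "E \<subseteq> V" "V \<subseteq> \<Omega>" "open_variation V \<le> outer_variation E + ennreal e"
proof -
  have "outer_variation E < top"
    using outer_variation_lower[OF open_domain assms(1)] open_variation_finite[of \<Omega>] by auto
  then have "outer_variation E < outer_variation E + ennreal e"
    using assms(2) by (cases "outer_variation E") (simp_all add: ennreal_less_iff flip: ennreal_plus)
  then show ?thesis
    unfolding outer_variation_def INF_less_iff using that
    by (auto simp: outer_variation_def intro: less_imp_le)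
qed

lemma outer_measure_space_outer_variation: "outer_measure_space (Pow \<Omega>) outer_variation"
  unfolding outer_measure_space_def
proof (intro conjI)
  show "positive (Pow \<Omega>) outer_variation"
    by (simp add: positive_def outer_variation_open open_variation_empty)
  show "increasing (Pow \<Omega>) outer_variation"
    by (simp add: increasing_def outer_variation_mono)
  show "countably_subadditive (Pow \<Omega>) outer_variation"
    unfolding countably_subadditive_def
  proof (intro allI impI)
    fix E :: "nat \<Rightarrow> _" assume E: "range E \<subseteq> Pow \<Omega>"
    show "outer_variation (\<Union>i. E i) \<le> (\<Sum>i. outer_variation (E i))"
    proof (rule ennreal_le_epsilon)
      fix e :: real assume "e > 0"
      have "\<exists>V. open V \<and> E i \<subseteq> V \<and> V \<subseteq> \<Omega> \<and> open_variation V \<le> outer_variation (E i) + ennreal (e * (1/2) ^ Suc i)" for i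
      proof -
        have "E i \<subseteq> \<Omega>" "e * (1/2) ^ Suc i > 0"
          using E \<open>e > 0\<close> by auto
        then show ?thesis
          by (rule outer_variation_approx) blast
      qed
      then obtain V where V: "\<And>i. open (V i)" "\<And>i. E i \<subseteq> V i" "\<And>i. V i \<subseteq> \<Omega>"
        "\<And>i. open_variation (V i) \<le> outer_variation (E i) + ennreal (e * (1/2) ^ Suc i)"
        by metis
      have "outer_variation (\<Union>i. E i) \<le> open_variation (\<Union>i. V i)"
        using V(2) by (intro outer_variation_lower open_UN UN_least ballI V(1,3)) fast
      also have "\<dots> \<le> (\<Sum>i. open_variation (V i))"
        using V by (intro open_variation_UN) auto
      also have "\<dots> \<le> (\<Sum>i. outer_variation (E i) + ennreal (e * (1/2) ^ Suc i))"
        using V by (intro suminf_le) auto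
      also have "\<dots> = (\<Sum>i. outer_variation (E i)) + (\<Sum>i. ennreal (e * (1/2) ^ Suc i))"
        by (simp add: suminf_add[symmetric])
      also have "(\<Sum>i. ennreal (e * (1/2) ^ Suc i)) = ennreal (e * 1)"
        using \<open>e > 0\<close> by (intro suminf_ennreal_eq sums_mult power_half_series) auto
      finally show "outer_variation (\<Union>i. E i) \<le> (\<Sum>i. outer_variation (E i)) + ennreal e"
        by simp
    qed
  qed
qed

text \<open>Let \<open>V\<close> be open around \<open>E\<close>. Take \<phi> supported in a compact
  \<open>K\<close> inside \<open>V \<inter> U\<close>, then \<psi> supported in
  \<open>V - K\<close>, which is open and contains \<open>V - U\<close>. At each point one of the
  two vanishes, so their sum still has norm at most 1 and competes for \<open>V\<close>, while
  \<open>L\<close> adds. Choosing \<phi> before \<psi> is what separates \<open>V \<inter> U\<close>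
  from the non-open set \<open>V - U\<close>.\<close>

lemma open_in_lambda_system:
  assumes U: "open U" "U \<subseteq> \<Omega>"
  shows "U \<in> lambda_system \<Omega> (Pow \<Omega>) outer_variation"
proof -
  interpret P: sigma_algebra \<Omega> "Pow \<Omega>"
    by (rule sigma_algebra_Pow)
  have sub: "subadditive (Pow \<Omega>) outer_variation"
    using outer_measure_space_outer_variation P.countably_subadditive_subadditive
    by (auto simp: outer_measure_space_def)
  have "outer_variation (E \<inter> U) + outer_variation (E - U) = outer_variation E" if "E \<subseteq> \<Omega>" for E
  proof (rule antisym)
    have "(E \<inter> U) \<union> (E - U) = E" by blast
    then show "outer_variation E \<le> outer_variation (E \<inter> U) + outer_variation (E - U)"
      using subadditiveD[OF sub, of "E \<inter> U" "E - U"] that by auto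
    show "outer_variation (E \<inter> U) + outer_variation (E - U) \<le> outer_variation E"
      unfolding outer_variation_def[of E]
    proof (rule INF_greatest)
      fix V assume "V \<in> {V. open V \<and> E \<subseteq> V \<and> V \<subseteq> \<Omega>}"
      then have V: "open V" "E \<subseteq> V" "V \<subseteq> \<Omega>" by auto
      have ne: "{\<phi> \<in> Cc_infinity W. \<forall>x. norm (\<phi> x) \<le> 1} \<noteq> ({} :: (real^'n \<Rightarrow> 'b) set)" for W
        using Cc_infinity_zero[of W] by force
      have "outer_variation (E \<inter> U) + outer_variation (E - U) \<le> open_variation (V \<inter> U) + outer_variation (V - U)"
        using V U by (intro add_mono outer_variation_lower outer_variation_mono) auto
      also have "\<dots> \<le> open_variation V"
        unfolding open_variation_def[of "V \<inter> U"] ennreal_SUP_add_left[OF ne, symmetric]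
      proof (rule SUP_least)
        fix \<phi> :: "real^'n \<Rightarrow> 'b" assume "\<phi> \<in> {\<phi> \<in> Cc_infinity (V \<inter> U). \<forall>x. norm (\<phi> x) \<le> 1}"
        then have \<phi>: "\<phi> \<in> Cc_infinity (V \<inter> U)" "\<And>x. norm (\<phi> x) \<le> 1" by auto
        obtain K where K: "compact K" "K \<subseteq> V \<inter> U" "\<And>x. x \<notin> K \<Longrightarrow> \<phi> x = 0"
          using Cc_infinityE[OF \<phi>(1)] by blast
        have \<phi>V: "\<phi> \<in> Cc_infinity V"
          using \<phi>(1) by (rule Cc_infinity_mono) auto
        have "outer_variation (V - U) \<le> open_variation (V - K)"
          using V K by (intro outer_variation_lower) (auto intro: open_Diff compact_imp_closed)
        then have "ennreal (L \<phi>) + outer_variation (V - U) \<le> ennreal (L \<phi>) + open_variation (V - K)"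
          by (rule add_left_mono)
        also have "\<dots> \<le> open_variation V"
          unfolding open_variation_def[of "V - K"] ennreal_SUP_add_right[OF ne]
        proof (rule SUP_least)
          fix \<psi> :: "real^'n \<Rightarrow> 'b" assume "\<psi> \<in> {\<phi> \<in> Cc_infinity (V - K). \<forall>x. norm (\<phi> x) \<le> 1}"
          then have \<psi>: "\<psi> \<in> Cc_infinity (V - K)" "\<And>x. norm (\<psi> x) \<le> 1" by auto
          have \<psi>V: "\<psi> \<in> Cc_infinity V"
            using \<psi>(1) by (rule Cc_infinity_mono) auto
          have "norm (\<phi> x + \<psi> x) \<le> 1" for x
            using \<phi>(2)[of x] \<psi>(2)[of x] K(3)[of x] Cc_infinity_vanish[OF \<psi>(1), of x] by (cases "x \<in> K") auto
          then have "ennreal (L (\<lambda>x. \<phi> x + \<psi> x)) \<le> open_variation V"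
            by (intro open_variation_upper Cc_infinity_add \<phi>V \<psi>V)
          moreover have "L (\<lambda>x. \<phi> x + \<psi> x) = L \<phi> + L \<psi>"
            using V by (intro L_add Cc_infinity_mono[OF \<phi>V] Cc_infinity_mono[OF \<psi>V]) auto
          \<comment> \<open>If one of the two values is negative, it is truncated to 0 and the other
            field alone is the competitor.\<close>
          ultimately show "ennreal (L \<phi>) + ennreal (L \<psi>) \<le> open_variation V"
            using open_variation_upper[OF \<phi>V \<phi>(2)] open_variation_upper[OF \<psi>V \<psi>(2)]
            unfolding ennreal_plus_if by (cases "0 \<le> L \<phi>"; cases "0 \<le> L \<psi>") simp_all
        qed
        finally show "ennreal (L \<phi>) + outer_variation (V - U) \<le> open_variation V" .
      qed
      finally show "outer_variation (E \<inter> U) + outer_variation (E - U) \<le> open_variation V" .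
    qed
  qed
  then show ?thesis
    using U by (simp add: P.lambda_system_eq)
qed

definition variation :: "(real^'n) measure" where
  "variation = measure_of \<Omega> (sets (restrict_space borel \<Omega>)) outer_variation"

lemma sets_variation [simp, measurable_cong]: "sets variation = sets (restrict_space borel \<Omega>)"
  and space_variation [simp]: "space variation = \<Omega>"
proof -
  have "sets (restrict_space borel \<Omega>) \<subseteq> Pow \<Omega>"
    using sets.space_closed[of "restrict_space borel \<Omega>"] by (simp add: space_restrict_space)
  moreover have "sigma_sets \<Omega> (sets (restrict_space borel \<Omega>)) = sets (restrict_space borel \<Omega>)"
    using sets.sigma_sets_eq[of "restrict_space borel \<Omega>"] by (simp add: space_restrict_space)
  ultimately show "sets variation = sets (restrict_space borel \<Omega>)" "space variation = \<Omega>"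
    by (simp_all add: variation_def)
qed

text \<open>Caratheodory's theorem makes the outer variation a measure on its measurable sets. These
  contain the open subsets of \<Omega>, hence its Borel sets.\<close>

lemma emeasure_variation:
  assumes "B \<in> sets (restrict_space borel \<Omega>)"
  shows "emeasure variation B = outer_variation B"
proof -
  interpret P: sigma_algebra \<Omega> "Pow \<Omega>"
    by (rule sigma_algebra_Pow)
  let ?L = "lambda_system \<Omega> (Pow \<Omega>) outer_variation"
  have ms: "measure_space \<Omega> ?L outer_variation"
    by (rule P.caratheodory_lemma[OF outer_measure_space_outer_variation])
  then interpret L: sigma_algebra \<Omega> ?L
    by (simp add: measure_space_def)
  have sub: "sets (restrict_space borel \<Omega>) \<subseteq> ?L"
    unfolding sets_restrict_borel_open[OF open_domain]
    by (rule L.sigma_sets_subset) (use open_in_lambda_system in auto)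
  show ?thesis
  proof (rule emeasure_measure_of[OF variation_def])
    show "sets (restrict_space borel \<Omega>) \<subseteq> Pow \<Omega>"
      using sets.space_closed[of "restrict_space borel \<Omega>"] by (simp add: space_restrict_space)
    show "positive (sets variation) outer_variation"
      using ms by (auto simp: measure_space_def positive_def)
    show "countably_additive (sets variation) outer_variation"
      using ms sub unfolding measure_space_def countably_additive_def sets_variation
      by (meson order_trans subsetD)
  qed (use assms in simp)
qed

lemma emeasure_variation_open: "open V \<Longrightarrow> V \<subseteq> \<Omega> \<Longrightarrow> emeasure variation V = open_variation V"
  by (simp add: emeasure_variation open_in_sets_restrict_borel outer_variation_open)

lemma finite_measure_variation: "finite_measure variation"
  by (rule finite_measureI)
    (use open_variation_finite[of \<Omega>] in \<open>simp add: emeasure_variation_open[OF open_domain]\<close>)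

section \<open>Domination of the functional by its variation\<close>

text \<open>An upper Lebesgue sum: \<Omega> is cut into the level sets \<open>E k\<close> where the
  norm of \<phi> lies between k \<epsilon> and (k + 1) \<epsilon>. Each is enlarged to an open set
  of almost the same variation on which the upper level still bounds \<phi>, and the weighted finite
  estimate is applied.\<close>

lemma L_le_integral_variation:
  assumes \<phi>: "\<phi> \<in> Cc_infinity \<Omega>"
  shows "L \<phi> \<le> (LINT x|variation. norm (\<phi> x))"
proof -
  interpret finite_measure variation
    by (rule finite_measure_variation)
  obtain B where B: "B > 0" "\<And>x. norm (\<phi> x) \<le> B"
    using Cc_infinity_bounded[OF \<phi>] by blast
  define V where "V = measure variation \<Omega>"
  have [measurable]: "(\<lambda>x. norm (\<phi> x)) \<in> borel_measurable variation"
  proof -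
    have "(\<lambda>x. norm (\<phi> x)) \<in> borel_measurable (restrict_space borel \<Omega>)"
      by (intro measurable_restrict_space1 borel_measurable_continuous_onI continuous_on_norm
          Cc_infinity_continuous[OF \<phi>])
    then show ?thesis
      by (simp add: measurable_cong_sets[OF sets_variation refl])
  qed
  have int: "integrable variation (\<lambda>x. norm (\<phi> x))"
    using B by (intro integrable_const_bound[of _ B]) auto
  have main: "L \<phi> \<le> (LINT x|variation. norm (\<phi> x)) + (2 * B * V + 2 * B) * inverse (real (Suc n))" for n
  proof -
    \<comment> \<open>With this \<epsilon> the quotient of the norm by \<epsilon> is at most (n + 1)
      / 2, strictly below n + 1, so n + 1 levels suffice. The \<delta> is chosen so that n + 1
      errors of at most (n + 1) \<epsilon> \<delta> add up to at most \<epsilon>; together with the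
      rounding error \<epsilon> V this is the stated remainder.\<close>
    define \<epsilon> where "\<epsilon> = 2 * B / Suc n"
    define \<delta> where "\<delta> = 1 / (real (Suc n) * real (Suc n))"
    have pos: "\<epsilon> > 0" "\<delta> > 0"
      using B by (auto simp: \<epsilon>_def \<delta>_def)
    define E where "E k = {x \<in> space variation. nat \<lfloor>norm (\<phi> x) / \<epsilon>\<rfloor> = k}" for k
    have E[measurable]: "E k \<in> sets variation" for k
      unfolding E_def by measurable
    have ind: "integrable variation (indicator (E k) :: _ \<Rightarrow> real)" for k
      by (intro integrable_real_indicator E) (simp add: emeasure_eq_measure)
    have E_sub: "E k \<subseteq> \<Omega>" for k
      by (auto simp: E_def)
    have E_lt: "norm (\<phi> x) < (real k + 1) * \<epsilon>" if "x \<in> E k" for k x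
    proof -
      have "norm (\<phi> x) / \<epsilon> < real k + 1"
        using that pos by (auto simp: E_def)
      then show ?thesis
        using pos by (simp add: field_simps)
    qed
    have E_ex: "\<exists>k<Suc n. x \<in> E k" if "x \<in> \<Omega>" for x
    proof -
      have "norm (\<phi> x) / \<epsilon> \<le> real (Suc n) / 2"
        using B(1) mult_right_mono[OF B(2)[of x], of "real (Suc n)"]
        by (simp add: \<epsilon>_def field_simps del: of_nat_Suc)
      then have "norm (\<phi> x) / \<epsilon> < real (Suc n)"
        by (simp add: field_simps)
      then have "nat \<lfloor>norm (\<phi> x) / \<epsilon>\<rfloor> < Suc n"
        by linarith
      then show ?thesis
        using that by (auto simp: E_def)
    qed
    have "\<exists>W. open W \<and> E k \<subseteq> W \<and> W \<subseteq> \<Omega> \<and> open_variation W \<le> emeasure variation (E k) + ennreal \<delta> \<and>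
        (\<forall>x\<in>W. norm (\<phi> x) \<le> (real k + 1) * \<epsilon>)" for k
    proof -
      obtain W where W: "open W" "E k \<subseteq> W" "W \<subseteq> \<Omega>" "open_variation W \<le> outer_variation (E k) + ennreal \<delta>"
        using outer_variation_approx[OF E_sub pos(2)] by blast
      \<comment> \<open>Intersecting with an open sublevel set keeps \<open>E k\<close> inside, can
        only lower the variation, and secures the bound on \<phi>.\<close>
      let ?W = "W \<inter> {x. norm (\<phi> x) < (real k + 1) * \<epsilon>}"
      have "open ?W"
        using W(1) by (intro open_Int open_Collect_less continuous_intros Cc_infinity_continuous[OF \<phi>])
      moreover have "open_variation ?W \<le> outer_variation (E k) + ennreal \<delta>"
        using open_variation_mono[of ?W W] W(4) by auto
      ultimately show ?thesis
        using W(2,3) E_lt[of _ k] E[of k]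
        by (intro exI[of _ ?W]) (auto simp: emeasure_variation less_imp_le)
    qed
    then obtain W where W: "\<And>k::nat. open (W k)" "\<And>k. E k \<subseteq> W k" "\<And>k. W k \<subseteq> \<Omega>"
      "\<And>k. open_variation (W k) \<le> emeasure variation (E k) + ennreal \<delta>"
      "\<And>k x. x \<in> W k \<Longrightarrow> norm (\<phi> x) \<le> (real k + 1) * \<epsilon>"
      by metis
    have "\<phi> \<in> Cc_infinity (\<Union>k\<in>{..<Suc n}. W k)"
      using \<phi> by (rule Cc_infinity_mono) (use E_ex W(2) in fast)
    then have "ennreal (L \<phi>) \<le> (\<Sum>k<Suc n. ennreal ((real k + 1) * \<epsilon>) * open_variation (W k))"
      using W pos by (intro L_le_sum_open_variation) auto
    also have "\<dots> \<le> (\<Sum>k<Suc n. ennreal ((real k + 1) * \<epsilon>) * ennreal (measure variation (E k) + \<delta>))"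
      using W(4) pos by (intro sum_mono mult_left_mono) (auto simp: emeasure_eq_measure)
    also have "\<dots> = ennreal (\<Sum>k<Suc n. (real k + 1) * \<epsilon> * (measure variation (E k) + \<delta>))"
      using pos by (subst sum_ennreal[symmetric]) (auto simp: ennreal_mult simp del: sum.lessThan_Suc)
    finally have "L \<phi> \<le> (\<Sum>k<Suc n. (real k + 1) * \<epsilon> * (measure variation (E k) + \<delta>))"
      using pos by (subst (asm) ennreal_le_iff) (auto intro!: sum_nonneg simp del: sum.lessThan_Suc)
    also have "\<dots> = (\<Sum>k<Suc n. (real k + 1) * \<epsilon> * measure variation (E k)) + (\<Sum>k<Suc n. (real k + 1) * \<epsilon> * \<delta>)"
      by (simp add: distrib_left sum.distrib del: sum.lessThan_Suc)
    also have "(\<Sum>k<Suc n. (real k + 1) * \<epsilon> * measure variation (E k))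
        = (LINT x|variation. (\<Sum>k<Suc n. (real k + 1) * \<epsilon> * indicator (E k) x))"
      by (subst Bochner_Integration.integral_sum)
        (auto simp: Int_absorb2[OF E_sub] ind simp del: sum.lessThan_Suc)
    also have "\<dots> \<le> (LINT x|variation. norm (\<phi> x) + \<epsilon>)"
    proof (rule integral_mono)
      show "integrable variation (\<lambda>x. \<Sum>k<Suc n. (real k + 1) * \<epsilon> * indicator (E k) x)"
        by (intro Bochner_Integration.integrable_sum integrable_mult_right) (rule ind)
      show "integrable variation (\<lambda>x. norm (\<phi> x) + \<epsilon>)"
        using int by auto
      fix x assume "x \<in> space variation"
      define j where "j = nat \<lfloor>norm (\<phi> x) / \<epsilon>\<rfloor>"
      have "(\<Sum>k<Suc n. (real k + 1) * \<epsilon> * indicator (E k) x) = (\<Sum>k<Suc n. if k = j then (real k + 1) * \<epsilon> else 0)"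
        using \<open>x \<in> space variation\<close> by (intro sum.cong) (auto simp: E_def j_def)
      also have "\<dots> \<le> (real j + 1) * \<epsilon>"
        using pos by (simp del: sum.lessThan_Suc)
      also have "real j \<le> norm (\<phi> x) / \<epsilon>"
        using pos by (simp add: j_def)
      then have "(real j + 1) * \<epsilon> \<le> norm (\<phi> x) + \<epsilon>"
        using pos by (simp add: field_simps)
      finally show "(\<Sum>k<Suc n. (real k + 1) * \<epsilon> * indicator (E k) x) \<le> norm (\<phi> x) + \<epsilon>"
        by simp
    qed
    also have "\<dots> = (LINT x|variation. norm (\<phi> x)) + \<epsilon> * V"
      using int by (simp add: V_def mult.commute)
    also have "(\<Sum>k<Suc n. (real k + 1) * \<epsilon> * \<delta>) \<le> (\<Sum>k<Suc n. (Suc n) * \<epsilon> * \<delta>)"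
      using pos by (intro sum_mono mult_right_mono) auto
    also have "\<dots> = \<epsilon>"
      by (simp add: \<delta>_def del: of_nat_Suc sum.lessThan_Suc)
    finally show ?thesis
      by (simp add: \<epsilon>_def divide_inverse algebra_simps)
  qed
  have "(\<lambda>n. (LINT x|variation. norm (\<phi> x)) + (2 * B * V + 2 * B) * inverse (real (Suc n)))
      \<longlonglongrightarrow> (LINT x|variation. norm (\<phi> x)) + (2 * B * V + 2 * B) * 0"
    by (intro tendsto_intros LIMSEQ_inverse_real_of_nat)
  then have "L \<phi> \<le> (LINT x|variation. norm (\<phi> x)) + (2 * B * V + 2 * B) * 0"
    by (rule LIMSEQ_le_const) (use main in blast)
  then show ?thesis
    by simp
qed

end

text \<open>One inequality is domination by the variation. The converse comes from applying it to \<open>\<eta> - \<phi>\<close> for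
  cutoffs \<open>\<eta>\<close>, since these almost attain the total mass.\<close>

lemma positive_functional_representation:
  fixes L :: "(real^'n::finite \<Rightarrow> real) \<Rightarrow> real"
  assumes "test_functional \<Omega> L C"
    and pos: "\<And>\<phi>. \<phi> \<in> Cc_infinity \<Omega> \<Longrightarrow> (\<And>x. 0 \<le> \<phi> x) \<Longrightarrow> 0 \<le> L \<phi>"
  obtains N where "finite_measure N" "sets N = sets (restrict_space borel \<Omega>)"
    "\<And>\<phi>. \<phi> \<in> Cc_infinity \<Omega> \<Longrightarrow> L \<phi> = integral\<^sup>L N \<phi>"
proof -
  interpret test_functional \<Omega> L C by fact
  interpret N: finite_measure variation
    by (rule finite_measure_variation)
  note int = Cc_infinity_integrable[OF finite_measure_variation sets_variation]
  have upper: "L \<phi> \<le> integral\<^sup>L variation \<phi>" if "\<phi> \<in> Cc_infinity \<Omega>" "\<And>x. 0 \<le> \<phi> x" for \<phi>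
    using L_le_integral_variation[OF that(1)] that(2) by simp
  have lower: "integral\<^sup>L variation \<phi> \<le> L \<phi>"
    if \<phi>: "\<phi> \<in> Cc_infinity \<Omega>" "\<And>x. 0 \<le> \<phi> x" "\<And>x. \<phi> x \<le> 1" for \<phi>
  proof (rule field_le_epsilon)
    fix e :: real assume "e > 0"
    \<comment> \<open>The total mass is a supremum of truncated values, so a near-maximiser is found
      directly only when the mass minus \<open>e\<close> is nonnegative. Otherwise the zero function
      does.\<close>
    have "\<exists>\<theta>\<in>{\<phi> \<in> Cc_infinity \<Omega>. \<forall>x. norm (\<phi> x) \<le> 1}. measure variation \<Omega> - e < L \<theta>"
    proof (cases "measure variation \<Omega> - e < 0")
      case True
      then show ?thesis
        using Cc_infinity_zero[of \<Omega>] L_zero by (intro bexI[of _ "\<lambda>x. 0"]) auto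
    next
      case False
      have "ennreal (measure variation \<Omega> - e) < emeasure variation \<Omega>"
        using \<open>e > 0\<close> False by (simp add: N.emeasure_eq_measure ennreal_less_iff)
      then have "\<exists>\<theta>\<in>{\<phi> \<in> Cc_infinity \<Omega>. \<forall>x. norm (\<phi> x) \<le> 1}. ennreal (measure variation \<Omega> - e) < ennreal (L \<theta>)"
        by (simp add: emeasure_variation_open[OF open_domain] open_variation_def less_SUP_iff)
      then show ?thesis
        using False by (auto simp: ennreal_less_iff)
    qed
    then obtain \<theta> where \<theta>: "\<theta> \<in> Cc_infinity \<Omega>" "\<And>x. \<bar>\<theta> x\<bar> \<le> 1" "measure variation \<Omega> - e < L \<theta>"
      by auto
    obtain K where K: "compact K" "K \<subseteq> \<Omega>" "\<And>x. x \<notin> K \<Longrightarrow> \<phi> x = 0"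
      using Cc_infinityE[OF \<phi>(1)] by metis
    obtain K' where K': "compact K'" "K' \<subseteq> \<Omega>" "\<And>x. x \<notin> K' \<Longrightarrow> \<theta> x = 0"
      using Cc_infinityE[OF \<theta>(1)] by metis
    have KK': "compact (K \<union> K')" "K \<union> K' \<subseteq> \<Omega>"
      using K K' by auto
    obtain \<eta> G where \<eta>: "\<eta> \<in> Cc_infinity \<Omega>" "\<And>x. 0 \<le> \<eta> x" "\<And>x. \<eta> x \<le> (1::real)"
      and G: "K \<union> K' \<subseteq> G" "\<And>x. x \<in> G \<Longrightarrow> \<eta> x = 1"
      by (rule cutoff_exists[OF KK'(1) open_domain KK'(2)]) blast
    have \<eta>1: "\<eta> x = 1" if "x \<in> K \<union> K'" for x
      using G that by blast
    \<comment> \<open>\<eta> is 1 on \<open>K'\<close> and \<theta> vanishes elsewhere, so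
      positivity of \<open>L\<close> gives \<open>L \<theta> \<le> L \<eta>\<close> and \<eta>
      nearly attains the total mass. As \<eta> also dominates \<phi>, the upper bound for \<eta> -
      \<phi> then becomes a lower bound for \<phi>.\<close>
    have "0 \<le> \<eta> x - \<theta> x" for x
      using \<eta>(2)[of x] \<eta>1[of x] \<theta>(2)[of x] K'(3)[of x] by (cases "x \<in> K'") auto
    then have "L \<theta> \<le> L \<eta>"
      using pos[OF Cc_infinity_diff[OF \<eta>(1) \<theta>(1)]] L_diff[OF \<eta>(1) \<theta>(1)] by simp
    have "0 \<le> \<eta> x - \<phi> x" for x
      using \<eta>(2)[of x] \<eta>1[of x] \<phi>(3)[of x] K(3)[of x] by (cases "x \<in> K") auto
    then have "L \<eta> - L \<phi> \<le> integral\<^sup>L variation \<eta> - integral\<^sup>L variation \<phi>"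
      using upper[OF Cc_infinity_diff[OF \<eta>(1) \<phi>(1)]] L_diff[OF \<eta>(1) \<phi>(1)] int[OF \<eta>(1)] int[OF \<phi>(1)] by simp
    moreover have "integral\<^sup>L variation \<eta> \<le> integral\<^sup>L variation (\<lambda>x. 1)"
      using \<eta> int by (intro integral_mono) auto
    ultimately show "integral\<^sup>L variation \<phi> \<le> L \<phi> + e"
      using \<theta>(3) \<open>L \<theta> \<le> L \<eta>\<close> by simp
  qed
  have eq: "L \<phi> = integral\<^sup>L variation \<phi>"
    if "\<phi> \<in> Cc_infinity \<Omega>" "\<And>x. 0 \<le> \<phi> x" "\<And>x. \<phi> x \<le> 1" for \<phi>
    using upper[OF that(1,2)] lower[OF that] by simp
  have "L \<phi> = integral\<^sup>L variation \<phi>" if \<phi>: "\<phi> \<in> Cc_infinity \<Omega>" for \<phi>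
  proof -
    obtain B where B: "B > 0" "\<And>x. \<bar>\<phi> x\<bar> \<le> B"
      using Cc_infinity_bounded[OF \<phi>] by (metis real_norm_def)
    obtain K where K: "compact K" "K \<subseteq> \<Omega>" "\<And>x. x \<notin> K \<Longrightarrow> \<phi> x = 0"
      using Cc_infinityE[OF \<phi>] by metis
    obtain \<eta> G where \<eta>: "\<eta> \<in> Cc_infinity \<Omega>" "\<And>x. 0 \<le> \<eta> x" "\<And>x. \<eta> x \<le> (1::real)"
      and G: "K \<subseteq> G" "\<And>x. x \<in> G \<Longrightarrow> \<eta> x = 1"
      by (rule cutoff_exists[OF K(1) open_domain K(2)]) blast
    have \<eta>1: "\<eta> x = 1" if "x \<in> K" for x
      using G that by blast
    \<comment> \<open>An affine change moves the values from the interval between -B and B into the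
      unit interval. The cutoff \<eta> replaces the constant 1, which has no compact support; it
      equals 1 wherever \<phi> can be nonzero.\<close>
    define \<psi> where "\<psi> x = (1 / (2 * B)) *\<^sub>R (\<phi> x + B *\<^sub>R \<eta> x)" for x
    have \<psi>: "\<psi> \<in> Cc_infinity \<Omega>"
      unfolding \<psi>_def by (intro Cc_infinity_scaleR Cc_infinity_add \<phi> \<eta>)
    have "0 \<le> \<psi> x \<and> \<psi> x \<le> 1" for x
      using B(1) B(2)[of x] \<eta>1[of x] K(3)[of x] \<eta>(2,3)[of x]
      by (cases "x \<in> K") (auto simp: \<psi>_def field_simps abs_le_iff)
    then have L\<psi>: "L \<psi> = integral\<^sup>L variation \<psi>"
      using eq[OF \<psi>] by blast
    have "L \<psi> = (1 / (2 * B)) * (L \<phi> + B * L \<eta>)"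
      unfolding \<psi>_def using \<phi> \<eta>
      by (simp only: L_scaleR L_add Cc_infinity_scaleR Cc_infinity_add)
    moreover have "integral\<^sup>L variation \<psi> = (1 / (2 * B)) * (integral\<^sup>L variation \<phi> + B * integral\<^sup>L variation \<eta>)"
      unfolding \<psi>_def using int[OF \<phi>] int[OF \<eta>(1)] by simp
    ultimately show ?thesis
      using L\<psi> eq[OF \<eta>(1-3)] B(1) by simp
  qed
  then show ?thesis
    using that[OF finite_measure_variation sets_variation] by blast
qed


section \<open>The measure of a vector-valued functional\<close>

text \<open>A finite \<epsilon>-net of the unit ball yields disjoint sets \<open>E j\<close> on
  which \<phi> is within \<epsilon> of a vector \<open>c j\<close> of norm at most 1. For the simple
  field the integral is the sum of \<open>c j \<bullet> \<mu> (E j)\<close>, bounded by the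
  variations of the \<open>E j\<close> through Cauchy-Schwarz. The replacement costs \<epsilon>
  times the masses \<open>R\<close>. The coordinates are given as \<open>P\<close> minus
  \<open>N i\<close>, the form in which they arise below.\<close>

lemma sum_integral_le_variation:
  fixes \<mu> :: "'a set \<Rightarrow> real^'n::finite"
  assumes \<mu>: "vector_measure M \<mu>" and fin: "total_variation M \<mu> (space M) < \<infinity>"
    and P: "finite_measure P" "sets P = sets M"
    and N: "\<And>i. finite_measure (N i)" "\<And>i. sets (N i) = sets M"
    and eq: "\<And>B i. \<mu> B $ i = measure P B - measure (N i) B"
    and \<phi>: "\<phi> \<in> borel_measurable M" "\<And>x. norm (\<phi> x) \<le> 1"
  shows "(\<Sum>i\<in>UNIV. (LINT x|P. \<phi> x $ i) - (LINT x|N i. \<phi> x $ i)) \<le> measure (variation_measure M \<mu>) (space M)"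
proof -
  let ?T = "variation_measure M \<mu>"
  define R where "R = (\<Sum>i\<in>UNIV. measure P (space M) + measure (N i) (space M))"
  have "R \<ge> 0"
    by (simp add: R_def sum_nonneg)
  interpret T: finite_measure ?T
    by (rule finite_variation_measure[OF \<mu> fin])
  have main: "(\<Sum>i\<in>UNIV. (LINT x|P. \<phi> x $ i) - (LINT x|N i. \<phi> x $ i)) \<le> measure ?T (space M) + \<epsilon> * R"
    if "\<epsilon> > 0" for \<epsilon>
  proof -
    have "compact (cball 0 1 :: (real^'n) set)" by simp
    then obtain F :: "(real^'n) set" where F: "F \<subseteq> cball 0 1" "finite F" "cball 0 1 \<subseteq> (\<Union>c\<in>F. ball c \<epsilon>)"
      by (rule compactE_image[of "cball 0 1" "cball 0 1" "\<lambda>c. ball c \<epsilon>"])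
        (use \<open>\<epsilon> > 0\<close> in auto)
    obtain c :: "nat \<Rightarrow> real^'n" and n where c: "F = c ` {i. i < n}"
      using F(2) by (metis finite_imp_nat_seg_image_inj_on)
    define A where "A j = {x \<in> space M. dist (c j) (\<phi> x) < \<epsilon>}" for j
    define E where "E = disjointed A"
    have "A j \<in> sets M" for j
      unfolding A_def using \<phi>(1) by measurable
    then have E[measurable]: "E j \<in> sets M" for j
      using sets.range_disjointed_sets'[of A M] by (auto simp: E_def)
    have disj: "disjoint_family E"
      by (simp add: E_def disjoint_family_disjointed)
    define s where "s x = (\<Sum>j<n. indicator (E j) x *\<^sub>R c j)" for x
    have s_close: "norm (\<phi> x - s x) \<le> \<epsilon>" if "x \<in> space M" for x
    proof -
      have "x \<in> (\<Union>j\<in>{0..<n}. A j)"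
        using F(3) \<phi>(2)[of x] that by (force simp: c A_def)
      then have "x \<in> (\<Union>j\<in>{0..<n}. E j)"
        by (simp add: E_def finite_UN_disjointed_eq)
      then obtain j where j: "j < n" "x \<in> E j"
        by auto
      have "indicator (E i) x = (if i = j then 1 else 0 :: real)" for i
        using j disjoint_family_onD[OF disj, of i j] by (auto simp: indicator_def)
      then have "s x = c j"
        using j(1) by (simp add: s_def if_distrib[of "\<lambda>r. r *\<^sub>R _"] cong: if_cong)
      moreover have "dist (c j) (\<phi> x) < \<epsilon>"
        using j(2) disjointed_subset[of A j] by (auto simp: E_def A_def)
      ultimately show ?thesis
        by (simp add: dist_norm norm_minus_commute)
    qed
    have int: "integrable Q (\<lambda>x. \<phi> x $ i)" "integrable Q (\<lambda>x. s x $ i)"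
      "(LINT x|Q. s x $ i) = (\<Sum>j<n. c j $ i * measure Q (E j))"
      "\<bar>(LINT x|Q. \<phi> x $ i) - (LINT x|Q. s x $ i)\<bar> \<le> \<epsilon> * measure Q (space M)"
      if Q: "finite_measure Q" and [measurable_cong]: "sets Q = sets M" for Q i
    proof -
      interpret Q: finite_measure Q by fact
      note space = sets_eq_imp_space_eq[OF \<open>sets Q = sets M\<close>]
      have [measurable]: "\<phi> \<in> borel_measurable Q"
        using \<phi>(1) by (simp add: measurable_cong_sets[OF \<open>sets Q = sets M\<close> refl])
      have "\<bar>\<phi> x $ i\<bar> \<le> 1" for x
        using component_le_norm_cart[of "\<phi> x" i] \<phi>(2)[of x] by linarith
      then show i1: "integrable Q (\<lambda>x. \<phi> x $ i)"
        by (intro Q.integrable_const_bound[of _ 1]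
            measurable_compose[OF \<open>\<phi> \<in> borel_measurable Q\<close> borel_measurable_continuous_onI]
            continuous_intros) auto
      have s: "s x $ i = (\<Sum>j<n. c j $ i * indicator (E j) x)" for x
        by (simp add: s_def mult.commute)
      have ind: "integrable Q (indicator (E j) :: _ \<Rightarrow> real)" for j
        by (intro integrable_real_indicator) (auto simp: Q.emeasure_eq_measure)
      show i2: "integrable Q (\<lambda>x. s x $ i)"
        unfolding s by (intro Bochner_Integration.integrable_sum integrable_mult_right ind)
      show "(LINT x|Q. s x $ i) = (\<Sum>j<n. c j $ i * measure Q (E j))"
        unfolding s by (subst Bochner_Integration.integral_sum) (simp_all add: ind)
      have "\<bar>(LINT x|Q. \<phi> x $ i) - (LINT x|Q. s x $ i)\<bar> = \<bar>LINT x|Q. \<phi> x $ i - s x $ i\<bar>"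
        using i1 i2 by simp
      also have "\<dots> \<le> (LINT x|Q. \<bar>\<phi> x $ i - s x $ i\<bar>)"
        by (rule integral_abs_bound)
      also have "\<dots> \<le> (LINT x|Q. \<epsilon>)"
      proof (rule integral_mono)
        fix x assume "x \<in> space Q"
        then show "\<bar>\<phi> x $ i - s x $ i\<bar> \<le> \<epsilon>"
          using component_le_norm_cart[of "\<phi> x - s x" i] s_close[of x] space by simp
      qed (use i1 i2 in auto)
      finally show "\<bar>(LINT x|Q. \<phi> x $ i) - (LINT x|Q. s x $ i)\<bar> \<le> \<epsilon> * measure Q (space M)"
        by (simp add: space mult.commute)
    qed
    have "(\<Sum>i\<in>UNIV. (LINT x|P. \<phi> x $ i) - (LINT x|N i. \<phi> x $ i))
        \<le> (\<Sum>i\<in>UNIV. ((LINT x|P. s x $ i) - (LINT x|N i. s x $ i)) + \<epsilon> * (measure P (space M) + measure (N i) (space M)))"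
    proof (rule sum_mono)
      fix i
      show "(LINT x|P. \<phi> x $ i) - (LINT x|N i. \<phi> x $ i) \<le> ((LINT x|P. s x $ i) - (LINT x|N i. s x $ i))
          + \<epsilon> * (measure P (space M) + measure (N i) (space M))"
        using int(4)[OF P, of i] int(4)[OF N, of i i] unfolding distrib_left by linarith
    qed
    also have "\<dots> = (\<Sum>i\<in>UNIV. \<Sum>j<n. c j $ i * \<mu> (E j) $ i) + \<epsilon> * R"
      by (subst sum.distrib) (simp add: R_def int(3)[OF P] int(3)[OF N] eq right_diff_distrib
          flip: sum_subtractf sum_distrib_left)
    also have "(\<Sum>i\<in>UNIV. \<Sum>j<n. c j $ i * \<mu> (E j) $ i) = (\<Sum>j<n. c j \<bullet> \<mu> (E j))"
      by (subst sum.swap) (simp add: inner_vec_def)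
    also have "\<dots> \<le> (\<Sum>j<n. measure ?T (E j))"
    proof (rule sum_mono)
      fix j assume "j \<in> {..<n}"
      then have "norm (c j) \<le> 1"
        using F(1) c by auto
      have "c j \<bullet> \<mu> (E j) \<le> norm (c j) * norm (\<mu> (E j))"
        by (rule norm_cauchy_schwarz)
      also have "\<dots> \<le> 1 * norm (\<mu> (E j))"
        using \<open>norm (c j) \<le> 1\<close> by (intro mult_right_mono) auto
      also have "\<dots> \<le> measure ?T (E j)"
        using norm_le_measure_variation_measure[OF \<mu> fin E] by simp
      finally show "c j \<bullet> \<mu> (E j) \<le> measure ?T (E j)" .
    qed
    also have "\<dots> = measure ?T (\<Union>j<n. E j)"
      using disj by (intro T.finite_measure_finite_Union[symmetric]) (auto simp: disjoint_family_on_def)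
    also have "\<dots> \<le> measure ?T (space M)"
      using T.bounded_measure by simp
    finally show ?thesis by simp
  qed
  show ?thesis
  proof (rule field_le_epsilon)
    fix e :: real assume "e > 0"
    \<comment> \<open>Dividing by \<open>R + 1\<close> instead of \<open>R\<close> also covers the
      case of zero masses.\<close>
    then have "(\<Sum>i\<in>UNIV. (LINT x|P. \<phi> x $ i) - (LINT x|N i. \<phi> x $ i)) \<le> measure ?T (space M) + e / (R + 1) * R"
      using \<open>R \<ge> 0\<close> by (intro main) auto
    also have "e / (R + 1) * R \<le> e"
      using \<open>R \<ge> 0\<close> \<open>e > 0\<close> by (simp add: field_simps)
    finally show "(\<Sum>i\<in>UNIV. (LINT x|P. \<phi> x $ i) - (LINT x|N i. \<phi> x $ i)) \<le> measure ?T (space M) + e"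
      by simp
  qed
qed

lemma LIMSEQ_integral_indicator_approx:
  fixes f :: "nat \<Rightarrow> real^'n::finite \<Rightarrow> real"
  assumes N: "finite_measure N" "sets N = sets (restrict_space borel \<Omega>)"
    and V: "open V" "V \<subseteq> \<Omega>"
    and f: "\<And>k. f k \<in> Cc_infinity V" "\<And>k x. 0 \<le> f k x" "\<And>k x. f k x \<le> 1"
      "\<And>x. (\<lambda>k. f k x) \<longlonglongrightarrow> indicator V x"
  shows "(\<lambda>k. integral\<^sup>L N (f k)) \<longlonglongrightarrow> measure N V"
proof -
  interpret finite_measure N by fact
  have [measurable]: "V \<in> sets N"
    using open_in_sets_restrict_borel[OF V] N(2) by simp
  have "(\<lambda>k. integral\<^sup>L N (f k)) \<longlonglongrightarrow> (LINT x|N. indicator V x)"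
    by (rule integral_dominated_convergence[where w = "\<lambda>_. 1"])
      (use f Cc_infinity_measurable[OF N(2) f(1)] in auto)
  then show ?thesis
    by simp
qed

lemma vector_functional_representation:
  fixes L :: "(real^'n::finite \<Rightarrow> real^'n) \<Rightarrow> real"
  assumes "test_functional \<Omega> L C"
  obtains \<mu> where "vector_measure (restrict_space borel \<Omega>) \<mu>"
    "total_variation (restrict_space borel \<Omega>) \<mu> \<Omega> = (SUP \<phi>\<in>{\<phi> \<in> Cc_infinity \<Omega>. \<forall>x. norm (\<phi> x) \<le> 1}. ennreal (L \<phi>))"
    "total_variation (restrict_space borel \<Omega>) \<mu> \<Omega> < \<infinity>"
    "\<And>\<phi>. \<phi> \<in> Cc_infinity \<Omega> \<Longrightarrow> L \<phi> = vector_integral \<Omega> \<mu> \<phi>"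
proof -
  interpret test_functional \<Omega> L C by fact
  let ?M = "restrict_space borel \<Omega>"
  interpret V: finite_measure variation
    by (rule finite_measure_variation)
  have space: "space ?M = \<Omega>"
    by (simp add: space_restrict_space)
  note int = Cc_infinity_integrable[OF finite_measure_variation sets_variation]
  have fe: "(\<lambda>x. f x *\<^sub>R e) \<in> Cc_infinity \<Omega>" if "f \<in> Cc_infinity \<Omega>" for f e
    by (rule Cc_infinity_bounded_linear[OF bounded_linear_scaleR_left that])
  have "\<exists>N. finite_measure N \<and> sets N = sets ?M \<and>
      (\<forall>f\<in>Cc_infinity \<Omega>. L (\<lambda>x. f x *\<^sub>R e) = integral\<^sup>L variation f - integral\<^sup>L N f)" if e: "norm e \<le> 1" for e
  proof -
    define \<Lambda> where "\<Lambda> f = integral\<^sup>L variation f - L (\<lambda>x. f x *\<^sub>R e)" for f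
    have upper: "L (\<lambda>x. f x *\<^sub>R e) \<le> (LINT x|variation. \<bar>f x\<bar>)" if f: "f \<in> Cc_infinity \<Omega>" for f
    proof -
      have "L (\<lambda>x. f x *\<^sub>R e) \<le> (LINT x|variation. norm (f x *\<^sub>R e))"
        by (rule L_le_integral_variation[OF fe[OF f]])
      also have "\<dots> = (LINT x|variation. \<bar>f x\<bar> * norm e)"
        by simp
      also have "\<dots> \<le> (LINT x|variation. \<bar>f x\<bar>)"
        using e int[OF f] by (intro integral_mono) (auto intro: mult_right_le_one_le)
      finally show ?thesis .
    qed
    \<comment> \<open>The term \<open>C\<close> comes from applying the bound of \<open>L\<close> to
      the negated field, which has norm at most 1 because \<open>e\<close> does.\<close>
    have \<Lambda>: "test_functional \<Omega> \<Lambda> (measure variation \<Omega> + C)"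
    proof
      show "open \<Omega>" by (rule open_domain)
      show "\<Lambda> (\<lambda>x. \<phi> x + \<psi> x) = \<Lambda> \<phi> + \<Lambda> \<psi>" if "\<phi> \<in> Cc_infinity \<Omega>" "\<psi> \<in> Cc_infinity \<Omega>" for \<phi> \<psi>
        using int[OF that(1)] int[OF that(2)] L_add[OF fe[OF that(1)] fe[OF that(2)]]
        by (simp add: \<Lambda>_def scaleR_add_left)
      show "\<Lambda> (\<lambda>x. c *\<^sub>R \<phi> x) = c * \<Lambda> \<phi>" if "\<phi> \<in> Cc_infinity \<Omega>" for \<phi> c
        using int[OF that] L_scaleR[OF fe[OF that], of c]
        by (simp add: \<Lambda>_def right_diff_distrib)
      show "\<Lambda> \<phi> \<le> measure variation \<Omega> + C" if \<phi>: "\<phi> \<in> Cc_infinity \<Omega>" "\<And>x. norm (\<phi> x) \<le> 1" for \<phi>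
      proof -
        have "integral\<^sup>L variation \<phi> \<le> (LINT x|variation. 1)"
          using \<phi>(2) int[OF \<phi>(1)] by (intro integral_mono) (auto simp: abs_le_iff)
        moreover have "L (\<lambda>x. (-1) *\<^sub>R (\<phi> x *\<^sub>R e)) \<le> C"
        proof (rule L_bound[OF Cc_infinity_scaleR[OF fe[OF \<phi>(1)]]])
          show "norm ((-1) *\<^sub>R (\<phi> x *\<^sub>R e)) \<le> 1" for x
            using mult_mono[OF \<phi>(2)[of x] e] by simp
        qed
        ultimately show ?thesis
          using L_scaleR[OF fe[OF \<phi>(1)], of "-1"] by (simp add: \<Lambda>_def)
      qed
    qed
    have "0 \<le> \<Lambda> f" if "f \<in> Cc_infinity \<Omega>" "\<And>x. 0 \<le> f x" for f
      using upper[OF that(1)] that(2) by (simp add: \<Lambda>_def)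
    then obtain N where "finite_measure N" "sets N = sets ?M" "\<And>f. f \<in> Cc_infinity \<Omega> \<Longrightarrow> \<Lambda> f = integral\<^sup>L N f"
      using positive_functional_representation[OF \<Lambda>] by metis
    then show ?thesis
      by (intro exI[of _ N]) (auto simp: \<Lambda>_def algebra_simps)
  qed
  then obtain N where N: "\<And>e. norm e \<le> 1 \<Longrightarrow> finite_measure (N e)" "\<And>e. norm e \<le> 1 \<Longrightarrow> sets (N e) = sets ?M"
    and N_eq: "\<And>e f. norm e \<le> 1 \<Longrightarrow> f \<in> Cc_infinity \<Omega> \<Longrightarrow> L (\<lambda>x. f x *\<^sub>R e) = integral\<^sup>L variation f - integral\<^sup>L (N e) f"
    by metis
  define D where "D e B = measure variation B - measure (N e) B" for e B
  define \<mu> where "\<mu> B = (\<Sum>i\<in>UNIV. D (axis i 1) B *\<^sub>R axis i (1::real))" for B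
  have D: "vector_measure ?M (D e)" if "norm e \<le> 1" for e
    unfolding D_def using N[OF that]
    by (intro vector_measure_diff vector_measure_measure finite_measure_variation) auto
  have axis: "norm (axis i (1::real) :: real^'n) \<le> 1" for i
    by simp
  have \<mu>_nth: "\<mu> B $ i = D (axis i 1) B" for B i
    by (simp add: \<mu>_def axis_def if_distrib cong: if_cong)
  have \<mu>: "vector_measure ?M \<mu>"
    unfolding \<mu>_def
    by (intro vector_measure_sum vector_measure_bounded_linear[OF D[OF axis] bounded_linear_scaleR_left])
  \<comment> \<open>The measures \<open>N e\<close> are chosen independently for each
    \<open>e\<close>, so \<open>D e\<close> is not linear in \<open>e\<close> by construction. On an
    open set it is the limit of \<open>L (f e)\<close> along cutoffs \<open>f\<close>, which is
    linear; the generator argument extends this to all Borel sets.\<close>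
  have inner_\<mu>: "(\<lambda>B. e \<bullet> \<mu> B) = D e" if e: "norm e \<le> 1" for e
  proof (rule vector_measure_eqI[OF vector_measure_bounded_linear[OF \<mu> bounded_linear_inner_right] D[OF e]])
    show "sets ?M = sigma_sets (space ?M) {V. open V \<and> V \<subseteq> \<Omega>}"
      by (simp only: space sets_restrict_borel_open[OF open_domain])
    show "Int_stable {V. open V \<and> V \<subseteq> \<Omega>}"
      by (auto simp: Int_stable_def)
    show "{V. open V \<and> V \<subseteq> \<Omega>} \<subseteq> Pow (space ?M)"
      by (auto simp: space)
    show open_eq: "e \<bullet> \<mu> V = D e V" if "V \<in> {V. open V \<and> V \<subseteq> \<Omega>}" for V
    proof -
      have V: "open V" "V \<subseteq> \<Omega>" using that by auto
      obtain f :: "nat \<Rightarrow> real^'n \<Rightarrow> real" where f: "\<And>k. f k \<in> Cc_infinity V" "\<And>k x. 0 \<le> f k x" "\<And>k x. f k x \<le> 1"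
        "\<And>x. (\<lambda>k. f k x) \<longlonglongrightarrow> indicator V x"
        using smooth_indicator_approx[OF V(1)] by metis
      have f\<Omega>: "f k \<in> Cc_infinity \<Omega>" for k
        using f(1) V(2) by (rule Cc_infinity_mono)
      have lim: "(\<lambda>k. L (\<lambda>x. f k x *\<^sub>R e')) \<longlonglongrightarrow> D e' V" if "norm e' \<le> 1" for e'
        unfolding N_eq[OF that f\<Omega>] D_def
        by (intro tendsto_diff LIMSEQ_integral_indicator_approx[OF _ _ V f] finite_measure_variation
            sets_variation N that)
      have "L (\<lambda>x. f k x *\<^sub>R e) = (\<Sum>i\<in>UNIV. e $ i * L (\<lambda>x. f k x *\<^sub>R axis i 1))" for k
      proof -
        have "(\<lambda>x. f k x *\<^sub>R e) = (\<lambda>x. \<Sum>i\<in>UNIV. e $ i *\<^sub>R (f k x *\<^sub>R axis i 1))"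
        proof
          fix x
          have "f k x *\<^sub>R e = f k x *\<^sub>R (\<Sum>i\<in>UNIV. e $ i *\<^sub>R axis i 1)"
            using basis_expansion[of e] by (simp add: scalar_mult_eq_scaleR)
          then show "f k x *\<^sub>R e = (\<Sum>i\<in>UNIV. e $ i *\<^sub>R (f k x *\<^sub>R axis i 1))"
            by (simp add: scaleR_sum_right mult.commute)
        qed
        then show ?thesis
          by (simp only: L_sum L_scaleR Cc_infinity_scaleR fe[OF f\<Omega>])
      qed
      moreover have "(\<lambda>k. \<Sum>i\<in>UNIV. e $ i * L (\<lambda>x. f k x *\<^sub>R axis i 1)) \<longlonglongrightarrow> (\<Sum>i\<in>UNIV. e $ i * D (axis i 1) V)"
        by (intro tendsto_intros lim axis)
      ultimately have "(\<Sum>i\<in>UNIV. e $ i * D (axis i 1) V) = D e V"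
        using lim[OF e] by (simp add: LIMSEQ_unique)
      then show ?thesis
        by (simp add: inner_vec_def \<mu>_nth)
    qed
    show "e \<bullet> \<mu> (space ?M) = D e (space ?M)"
      using open_eq[of \<Omega>] open_domain by (simp add: space)
  qed
  have norm_\<mu>: "norm (\<mu> B) \<le> measure variation B" for B
  proof -
    \<comment> \<open>The direction depends on \<open>B\<close>, which is why all of the unit ball
      was treated. Its inner product with \<mu>(B) is the full Euclidean norm, so no dimensional
      constant is lost; for \<mu>(B) = 0 the direction is 0, also in the ball.\<close>
    have "sgn (\<mu> B) \<bullet> \<mu> B = D (sgn (\<mu> B)) B"
      using inner_\<mu>[of "sgn (\<mu> B)"] by (metis norm_sgn order_refl zero_le_one)
    moreover have "sgn (\<mu> B) \<bullet> \<mu> B = norm (\<mu> B)"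
      by (cases "\<mu> B = 0") (simp_all add: sgn_div_norm power2_norm_eq_inner[symmetric] power2_eq_square)
    ultimately show ?thesis
      by (simp add: D_def)
  qed
  have tv_le: "total_variation ?M \<mu> \<Omega> \<le> open_variation \<Omega>"
  proof (rule total_variation_bounded)
    fix E :: "nat \<Rightarrow> _" assume E: "range E \<subseteq> sets ?M" "disjoint_family E" "(\<Union>k. E k) = \<Omega>"
    have "(\<Sum>k. ennreal (norm (\<mu> (E k)))) \<le> (\<Sum>k. emeasure variation (E k))"
      using norm_\<mu> by (intro suminf_le) (auto simp: V.emeasure_eq_measure)
    also have "\<dots> = emeasure variation \<Omega>"
      using E suminf_emeasure[of E variation] by simp
    finally show "(\<Sum>k. ennreal (norm (\<mu> (E k)))) \<le> open_variation \<Omega>"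
      by (simp add: emeasure_variation_open[OF open_domain])
  qed
  have fin: "total_variation ?M \<mu> \<Omega> < \<infinity>"
    using tv_le open_variation_finite[of \<Omega>] by (simp add: le_less_trans)
  have fin': "total_variation ?M (\<lambda>B. \<mu> B $ i) (space ?M) < \<infinity>" for i
    using total_variation_mono_norm[of ?M "\<lambda>B. \<mu> B $ i" \<mu> \<Omega>] component_le_norm_cart fin
    by (auto simp: space intro: le_less_trans)
  have repr: "L \<phi> = (\<Sum>i\<in>UNIV. (LINT x|variation. \<phi> x $ i) - (LINT x|N (axis i 1). \<phi> x $ i))"
    if \<phi>: "\<phi> \<in> Cc_infinity \<Omega>" for \<phi>
  proof -
    have \<phi>_nth: "(\<lambda>x. \<phi> x $ i) \<in> Cc_infinity \<Omega>" for i
      by (rule Cc_infinity_bounded_linear[OF bounded_linear_vec_nth \<phi>])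
    have "\<phi> = (\<lambda>x. \<Sum>i\<in>UNIV. \<phi> x $ i *\<^sub>R axis i 1)"
      by (simp add: basis_expansion flip: scalar_mult_eq_scaleR)
    then have "L \<phi> = (\<Sum>i\<in>UNIV. L (\<lambda>x. \<phi> x $ i *\<^sub>R axis i 1))"
      using L_sum[of UNIV "\<lambda>i x. \<phi> x $ i *\<^sub>R axis i 1", OF fe[OF \<phi>_nth]] by simp
    then show ?thesis
      by (simp add: N_eq[OF axis \<phi>_nth])
  qed
  have "L \<phi> = vector_integral \<Omega> \<mu> \<phi>" if \<phi>: "\<phi> \<in> Cc_infinity \<Omega>" for \<phi>
    unfolding vector_integral_def repr[OF \<phi>]
  proof (rule sum.cong[OF refl])
    fix i :: 'n
    obtain B where B: "\<And>x. norm (\<phi> x) \<le> B"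
      using Cc_infinity_bounded[OF \<phi>] by blast
    show "(LINT x|variation. \<phi> x $ i) - (LINT x|N (axis i 1). \<phi> x $ i) = signed_integral ?M (\<lambda>B. \<mu> B $ i) (\<lambda>x. \<phi> x $ i)"
    proof (rule signed_integral_eq[symmetric, OF vector_measure_bounded_linear[OF \<mu> bounded_linear_vec_nth] fin'
          finite_measure_variation N(1)[OF axis] sets_variation N(2)[OF axis]])
      show "\<mu> B $ i = measure variation B - measure (N (axis i 1)) B" for B
        by (simp add: \<mu>_nth D_def)
      show "(\<lambda>x. \<phi> x $ i) \<in> borel_measurable ?M"
        by (rule Cc_infinity_measurable[OF refl Cc_infinity_bounded_linear[OF bounded_linear_vec_nth \<phi>]])
      show "\<bar>\<phi> x $ i\<bar> \<le> B" for x
        using B[of x] component_le_norm_cart[of "\<phi> x" i] by linarith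
    qed
  qed
  moreover have "total_variation ?M \<mu> \<Omega> = open_variation \<Omega>"
  proof (rule antisym[OF tv_le])
    show "open_variation \<Omega> \<le> total_variation ?M \<mu> \<Omega>"
      unfolding open_variation_def
    proof (rule SUP_least)
      fix \<phi> :: "real^'n \<Rightarrow> real^'n" assume "\<phi> \<in> {\<phi> \<in> Cc_infinity \<Omega>. \<forall>x. norm (\<phi> x) \<le> 1}"
      then have \<phi>: "\<phi> \<in> Cc_infinity \<Omega>" "\<And>x. norm (\<phi> x) \<le> 1" by auto
      interpret T: finite_measure "variation_measure ?M \<mu>"
        using fin by (intro finite_variation_measure[OF \<mu>]) (simp add: space)
      have "L \<phi> \<le> measure (variation_measure ?M \<mu>) (space ?M)"
        unfolding repr[OF \<phi>(1)]
      proof (rule sum_integral_le_variation[OF \<mu> _ finite_measure_variation sets_variation N(1)[OF axis] N(2)[OF axis]])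
        show "\<mu> B $ i = measure variation B - measure (N (axis i 1)) B" for B i
          by (simp add: \<mu>_nth D_def)
      qed (use fin \<phi> Cc_infinity_measurable[OF refl \<phi>(1)] in \<open>auto simp: space\<close>)
      then have "ennreal (L \<phi>) \<le> emeasure (variation_measure ?M \<mu>) (space ?M)"
        by (simp add: T.emeasure_eq_measure ennreal_leI)
      then show "ennreal (L \<phi>) \<le> total_variation ?M \<mu> \<Omega>"
        using emeasure_variation_measure[OF \<mu> sets.top] by (simp add: space)
    qed
  qed
  ultimately show ?thesis
    using that[OF \<mu>] fin by (simp add: open_variation_def)
qed


section \<open>Magnetic variation\<close>

text \<open>Finitely many of the neighbourhoods cover the compact closure of \<Omega>. The resulting
  uniform bound makes the product of A \<bullet> \<phi> with an integrable function
  integrable.\<close>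

lemma locally_bounded_bounded_on:
  fixes A :: "real^'n::finite \<Rightarrow> 'b::real_normed_vector"
  assumes "locally_bounded A" "bounded \<Omega>"
  obtains K where "K \<ge> 0" "\<And>x. x \<in> \<Omega> \<Longrightarrow> norm (A x) \<le> K"
proof -
  obtain U where U: "\<And>x. open (U x)" "\<And>x. x \<in> U x" "\<And>x. bounded (A ` U x)"
    using assms(1) unfolding locally_bounded_def by metis
  have "compact (closure \<Omega>)"
    using assms(2) by simp
  moreover have "closure \<Omega> \<subseteq> (\<Union>x\<in>closure \<Omega>. U x)"
    using U(2) by blast
  ultimately obtain F where F: "finite F" "closure \<Omega> \<subseteq> (\<Union>x\<in>F. U x)"
    using U(1) compactE_image[of "closure \<Omega>" "closure \<Omega>" U] by metis
  have "bounded (\<Union>x\<in>F. A ` U x)"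
    using F(1) U(3) by (intro bounded_Union) auto
  then obtain K where "K > 0" "\<And>y. y \<in> (\<Union>x\<in>F. A ` U x) \<Longrightarrow> norm y \<le> K"
    by (auto simp: bounded_pos)
  then show ?thesis
    using F(2) closure_subset[of \<Omega>] by (intro that[of K]) (auto, blast)
qed

lemma set_integrable_mult_bounded:
  fixes v g :: "'a \<Rightarrow> real"
  assumes "set_integrable M \<Omega> v" "g \<in> borel_measurable M" "\<And>x. x \<in> \<Omega> \<Longrightarrow> \<bar>g x\<bar> \<le> K"
  shows "set_integrable M \<Omega> (\<lambda>x. v x * g x)"
proof -
  have v: "integrable M (\<lambda>x. indicator \<Omega> x * v x)"
    using assms(1) by (simp add: set_integrable_def)
  have "integrable M (\<lambda>x. (indicator \<Omega> x * v x) * g x)"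
  proof (rule Bochner_Integration.integrable_bound)
    show "integrable M (\<lambda>x. K * (indicator \<Omega> x * v x))"
      using v by (rule integrable_mult_right)
    show "(\<lambda>x. (indicator \<Omega> x * v x) * g x) \<in> borel_measurable M"
      by (rule borel_measurable_times[OF borel_measurable_integrable[OF v] assms(2)])
    have "norm (indicator \<Omega> x * v x * g x) \<le> norm (K * (indicator \<Omega> x * v x))" for x
    proof (cases "x \<in> \<Omega>")
      case True
      then have "\<bar>v x\<bar> * \<bar>g x\<bar> \<le> \<bar>v x\<bar> * \<bar>K\<bar>"
        using assms(3)[of x] by (intro mult_left_mono) auto
      then show ?thesis
        using True by (simp add: abs_mult mult.commute)
    qed simp
    then show "AE x in M. norm (indicator \<Omega> x * v x * g x) \<le> norm (K * (indicator \<Omega> x * v x))"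
      by simp
  qed
  then show ?thesis
    by (simp add: set_integrable_def mult.assoc)
qed

lemma divergence_add:
  assumes "C_k 1 \<phi>" "C_k 1 \<psi>"
  shows "divergence (\<lambda>x. \<phi> x + \<psi> x) x = divergence \<phi> x + divergence \<psi> x"
proof -
  have *: "(\<phi> has_derivative frechet_derivative \<phi> (at x)) (at x)"
    "(\<psi> has_derivative frechet_derivative \<psi> (at x)) (at x)"
    using assms by (auto intro: C_k_Suc_derivative(1)[of 0])
  have "partial_deriv i (\<lambda>x. \<phi> x + \<psi> x) x = partial_deriv i \<phi> x + partial_deriv i \<psi> x" for i
    by (simp only: partial_deriv_eq[OF has_derivative_add[OF *]] partial_deriv_eq[OF *(1)] partial_deriv_eq[OF *(2)])
  then show ?thesis
    by (simp add: divergence_def sum.distrib)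
qed

lemma divergence_scaleR:
  assumes "C_k 1 \<phi>"
  shows "divergence (\<lambda>x. c *\<^sub>R \<phi> x) x = c * divergence \<phi> x"
proof -
  have *: "(\<phi> has_derivative frechet_derivative \<phi> (at x)) (at x)"
    using assms by (auto intro: C_k_Suc_derivative(1)[of 0])
  have "partial_deriv i (\<lambda>x. c *\<^sub>R \<phi> x) x = c *\<^sub>R partial_deriv i \<phi> x" for i
    by (simp only: partial_deriv_eq[OF has_derivative_scaleR_right[OF *]] partial_deriv_eq[OF *])
  then show ?thesis
    by (simp add: divergence_def sum_distrib_left)
qed

lemma continuous_on_divergence:
  assumes "C_k 1 \<phi>"
  shows "continuous_on S (divergence \<phi>)"
proof -
  have "continuous_on UNIV (partial_deriv i \<phi>)" for i
    using assms by simp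
  then have "continuous_on UNIV (\<lambda>x. \<Sum>i\<in>UNIV. partial_deriv i \<phi> x $ i)"
    by (intro continuous_intros)
  then show ?thesis
    unfolding divergence_def[abs_def] by (rule continuous_on_subset) simp
qed

text \<open>Translates the essential bound into the pointwise one used by
  \<open>test_functional\<close>. By continuity the points of \<Omega> where the norm exceeds 1 form
  an open set, and a nonempty open set is not negligible; off \<Omega> the field is 0.\<close>

lemma Linfinity_norm_le_1_iff:
  assumes "open \<Omega>" "\<phi> \<in> Cc_infinity \<Omega>"
  shows "Linfinity_norm \<Omega> \<phi> \<le> 1 \<longleftrightarrow> (\<forall>x. norm (\<phi> x) \<le> 1)"
proof
  note cont = Cc_infinity_continuous[OF assms(2)]
  have meas: "(\<lambda>x. ereal (norm (\<phi> x))) \<in> borel_measurable (lebesgue_on \<Omega>)"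
  proof -
    have "(\<lambda>x. norm (\<phi> x)) \<in> borel_measurable (lebesgue_on \<Omega>)"
      using assms(1) by (intro continuous_imp_measurable_on_sets_lebesgue continuous_on_norm cont) auto
    then show ?thesis by simp
  qed
  show "\<forall>x. norm (\<phi> x) \<le> 1" if le: "Linfinity_norm \<Omega> \<phi> \<le> 1"
  proof (rule ccontr)
    assume "\<not> (\<forall>x. norm (\<phi> x) \<le> 1)"
    then obtain y where y: "norm (\<phi> y) > 1"
      by (auto simp: not_le)
    then have "y \<in> \<Omega>"
      using Cc_infinity_vanish[OF assms(2)] by force
    let ?U = "\<Omega> \<inter> {x. 1 < norm (\<phi> x)}"
    have "AE x in lebesgue_on \<Omega>. ereal (norm (\<phi> x)) \<le> 1"
      using esssup_AE[of "\<lambda>x. ereal (norm (\<phi> x))" "lebesgue_on \<Omega>"]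
      by eventually_elim (rule order_trans[OF _ le[unfolded Linfinity_norm_def]])
    then have "AE x in lebesgue. x \<in> \<Omega> \<longrightarrow> norm (\<phi> x) \<le> 1"
      using assms(1) by (simp add: AE_restrict_space_iff)
    then have "negligible {x. \<not> (x \<in> \<Omega> \<longrightarrow> norm (\<phi> x) \<le> 1)}"
      using AE_iff_null_sets negligible_iff_null_sets eventually_ae_filter_negligible
      by (metis (mono_tags, lifting) eventually_ae_filter mem_Collect_eq negligible_subset subsetI)
    moreover have "{x. \<not> (x \<in> \<Omega> \<longrightarrow> norm (\<phi> x) \<le> 1)} = ?U"
      by auto
    moreover have "open ?U"
      using assms(1) by (intro open_Int open_Collect_less continuous_intros cont)
    ultimately show False
      using open_not_negligible[of ?U] y \<open>y \<in> \<Omega>\<close> by auto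
  qed
  show "Linfinity_norm \<Omega> \<phi> \<le> 1" if "\<forall>x. norm (\<phi> x) \<le> 1"
    unfolding Linfinity_norm_def using that meas by (intro esssup_I) auto
qed

text \<open>Common form of both functionals: (v, w) is (Re u, - Im u) for \<open>C1A\<close> and (Im
  u, Re u) for \<open>C2A\<close>. On the bounded set \<Omega> both the divergence and A \<bullet>
  \<phi> are bounded, so the integrals exist and are linear in \<phi>. Finiteness of
  \<open>S\<close> then supplies the operator bound.\<close>

lemma magnetic_functional_representation:
  fixes A :: "real^'n::finite \<Rightarrow> real^'n" and v w :: "real^'n \<Rightarrow> real"
  assumes \<Omega>: "open \<Omega>" "bounded \<Omega>"
    and A: "A \<in> borel_measurable lebesgue" "locally_bounded A"
    and vw: "set_integrable lebesgue \<Omega> v" "set_integrable lebesgue \<Omega> w"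
  defines "L \<equiv> \<lambda>\<phi>. LINT x:\<Omega>|lebesgue. v x * divergence \<phi> x + (A x \<bullet> \<phi> x) * w x"
  defines "S \<equiv> SUP \<phi>\<in>{\<phi> \<in> Cc_infinity \<Omega>. Linfinity_norm \<Omega> \<phi> \<le> 1}. ereal (L \<phi>)"
  assumes S: "S < \<infinity>"
  shows "\<And>\<phi>. \<phi> \<in> Cc_infinity \<Omega> \<Longrightarrow> set_integrable lebesgue \<Omega> (\<lambda>x. v x * divergence \<phi> x + (A x \<bullet> \<phi> x) * w x)"
    and "\<exists>\<mu>. vector_measure (restrict_space borel \<Omega>) \<mu> \<and>
      S = enn2ereal (total_variation (restrict_space borel \<Omega>) \<mu> \<Omega>) \<and>
      total_variation (restrict_space borel \<Omega>) \<mu> \<Omega> < \<infinity> \<and>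
      (\<forall>\<phi>\<in>Cc_infinity \<Omega>. L \<phi> = vector_integral \<Omega> \<mu> \<phi>)"
proof -
  obtain K where K: "K \<ge> 0" "\<And>x. x \<in> \<Omega> \<Longrightarrow> norm (A x) \<le> K"
    using locally_bounded_bounded_on[OF A(2) \<Omega>(2)] by blast
  show int: "set_integrable lebesgue \<Omega> (\<lambda>x. v x * divergence \<phi> x + (A x \<bullet> \<phi> x) * w x)"
    if \<phi>: "\<phi> \<in> Cc_infinity \<Omega>" for \<phi>
  proof -
    have cd: "continuous_on S (divergence \<phi>)" for S
      by (rule continuous_on_divergence[OF Cc_infinity_C_k[OF \<phi>]])
    have "bounded (divergence \<phi> ` closure \<Omega>)"
      using \<Omega>(2) cd by (intro compact_imp_bounded compact_continuous_image) auto
    then obtain D where D: "\<And>x. x \<in> closure \<Omega> \<Longrightarrow> \<bar>divergence \<phi> x\<bar> \<le> D"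
      by (auto simp: bounded_iff)
    have 1: "set_integrable lebesgue \<Omega> (\<lambda>x. v x * divergence \<phi> x)"
    proof (rule set_integrable_mult_bounded[OF vw(1)])
      show "divergence \<phi> \<in> borel_measurable lebesgue"
        using borel_measurable_continuous_onI[OF cd] by (simp add: measurable_completion)
      show "\<bar>divergence \<phi> x\<bar> \<le> D" if "x \<in> \<Omega>" for x
        using D that closure_subset by blast
    qed
    obtain B where B: "B > 0" "\<And>x. norm (\<phi> x) \<le> B"
      using Cc_infinity_bounded[OF \<phi>] by blast
    have 2: "set_integrable lebesgue \<Omega> (\<lambda>x. w x * (A x \<bullet> \<phi> x))"
    proof (rule set_integrable_mult_bounded[OF vw(2)])
      have "\<phi> \<in> borel_measurable lebesgue"
        using borel_measurable_continuous_onI[OF Cc_infinity_continuous[OF \<phi>]]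
        by (simp add: measurable_completion)
      then show "(\<lambda>x. A x \<bullet> \<phi> x) \<in> borel_measurable lebesgue"
        using A(1) by (intro borel_measurable_inner)
      show "\<bar>A x \<bullet> \<phi> x\<bar> \<le> K * B" if "x \<in> \<Omega>" for x
        using Cauchy_Schwarz_ineq2[of "A x" "\<phi> x"] mult_mono[OF K(2)[OF that] B(2)[of x]] K(1) by simp
    qed
    show ?thesis
      using set_integral_add(1)[OF 1 2] by (simp add: mult.commute)
  qed
  let ?T = "{\<phi> \<in> Cc_infinity \<Omega>. Linfinity_norm \<Omega> \<phi> \<le> 1}"
  have T: "?T = {\<phi> \<in> Cc_infinity \<Omega>. \<forall>x. norm (\<phi> x) \<le> 1}"
    using Linfinity_norm_le_1_iff[OF \<Omega>(1)] by blast
  have L_add: "L (\<lambda>x. \<phi> x + \<psi> x) = L \<phi> + L \<psi>" if "\<phi> \<in> Cc_infinity \<Omega>" "\<psi> \<in> Cc_infinity \<Omega>" for \<phi> \<psi>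
    unfolding L_def set_integral_add(2)[OF int[OF that(1)] int[OF that(2)], symmetric]
    by (simp add: divergence_add[OF Cc_infinity_C_k[OF that(1)] Cc_infinity_C_k[OF that(2)]] algebra_simps)
  have L_scaleR: "L (\<lambda>x. c *\<^sub>R \<phi> x) = c * L \<phi>" if "\<phi> \<in> Cc_infinity \<Omega>" for c \<phi>
    unfolding L_def set_integral_mult_right[symmetric]
    by (simp add: divergence_scaleR[OF Cc_infinity_C_k[OF that]] algebra_simps)
  have upper: "ereal (L \<phi>) \<le> S" if "\<phi> \<in> Cc_infinity \<Omega>" "\<And>x. norm (\<phi> x) \<le> 1" for \<phi>
    unfolding S_def T using that by (intro SUP_upper) auto
  have "L (\<lambda>x. 0) = 0"
    using L_scaleR[OF Cc_infinity_zero, of 0] by simp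
  then have "0 \<le> S"
    using upper[OF Cc_infinity_zero] by (simp add: zero_ereal_def)
  with S obtain C where C: "S = ereal C" "C \<ge> 0"
    by (cases S) auto
  have "test_functional \<Omega> L C"
    by standard (use \<Omega>(1) L_add L_scaleR upper C in auto)
  then obtain \<mu> where \<mu>: "vector_measure (restrict_space borel \<Omega>) \<mu>"
    "total_variation (restrict_space borel \<Omega>) \<mu> \<Omega> = (SUP \<phi>\<in>?T. ennreal (L \<phi>))"
    "total_variation (restrict_space borel \<Omega>) \<mu> \<Omega> < \<infinity>"
    "\<And>\<phi>. \<phi> \<in> Cc_infinity \<Omega> \<Longrightarrow> L \<phi> = vector_integral \<Omega> \<mu> \<phi>"
    unfolding T by (rule vector_functional_representation) blast
  \<comment> \<open>The supremum in \<open>ereal\<close> and that of the truncated values in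
    \<open>ennreal\<close> agree: truncation only raises values, and none above \<open>S\<close>
    since \<open>S\<close> is nonnegative.\<close>
  have "S = enn2ereal (SUP \<phi>\<in>?T. ennreal (L \<phi>))"
  proof (rule antisym)
    show "S \<le> enn2ereal (SUP \<phi>\<in>?T. ennreal (L \<phi>))"
      unfolding S_def
    proof (rule SUP_least)
      fix \<phi> assume "\<phi> \<in> ?T"
      then have "ennreal (L \<phi>) \<le> (SUP \<phi>\<in>?T. ennreal (L \<phi>))"
        by (rule SUP_upper)
      then have "enn2ereal (ennreal (L \<phi>)) \<le> enn2ereal (SUP \<phi>\<in>?T. ennreal (L \<phi>))"
        by (simp add: less_eq_ennreal.rep_eq)
      moreover have "ereal (L \<phi>) \<le> enn2ereal (ennreal (L \<phi>))"
        by (simp add: ennreal.rep_eq)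
      ultimately show "ereal (L \<phi>) \<le> enn2ereal (SUP \<phi>\<in>?T. ennreal (L \<phi>))"
        by (rule order_trans[rotated])
    qed
    have "(SUP \<phi>\<in>?T. ennreal (L \<phi>)) \<le> ennreal C"
      unfolding T using upper C by (intro SUP_least ennreal_leI) auto
    then show "enn2ereal (SUP \<phi>\<in>?T. ennreal (L \<phi>)) \<le> S"
      using C by (simp add: less_eq_ennreal.rep_eq)
  qed
  then show "\<exists>\<mu>. vector_measure (restrict_space borel \<Omega>) \<mu> \<and>
      S = enn2ereal (total_variation (restrict_space borel \<Omega>) \<mu> \<Omega>) \<and>
      total_variation (restrict_space borel \<Omega>) \<mu> \<Omega> < \<infinity> \<and>
      (\<forall>\<phi>\<in>Cc_infinity \<Omega>. L \<phi> = vector_integral \<Omega> \<mu> \<phi>)"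
    using \<mu> by auto
qed

section \<open>Uniqueness of the representing measure\<close>

text \<open>Testing with f times a coordinate vector, where f runs through cutoffs tending to the
  indicator of an open \<open>V\<close>, recovers that coordinate of the measure of
  \<open>V\<close>. Finite total variation provides the Jordan parts for dominated convergence, and
  the open subsets determine the measure.\<close>

lemma vector_measure_unique:
  fixes \<mu> \<nu> :: "(real^'n::finite) set \<Rightarrow> real^'n"
  assumes \<Omega>: "open \<Omega>"
    and \<mu>: "vector_measure (restrict_space borel \<Omega>) \<mu>" "total_variation (restrict_space borel \<Omega>) \<mu> \<Omega> < \<infinity>"
    and \<nu>: "vector_measure (restrict_space borel \<Omega>) \<nu>" "total_variation (restrict_space borel \<Omega>) \<nu> \<Omega> < \<infinity>"
    and eq: "\<And>\<phi>. \<phi> \<in> Cc_infinity \<Omega> \<Longrightarrow> vector_integral \<Omega> \<mu> \<phi> = vector_integral \<Omega> \<nu> \<phi>"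
  shows "\<mu> = \<nu>"
proof -
  let ?M = "restrict_space borel \<Omega>"
  have space: "space ?M = \<Omega>"
    by (simp add: space_restrict_space)
  have lim: "(\<lambda>k. vector_integral \<Omega> \<rho> (\<lambda>x. f k x *\<^sub>R axis i 1)) \<longlonglongrightarrow> \<rho> V $ i"
    if \<rho>: "vector_measure ?M \<rho>" "total_variation ?M \<rho> \<Omega> < \<infinity>" and V: "open V" "V \<subseteq> \<Omega>"
      and f: "\<And>k. f k \<in> Cc_infinity V" "\<And>k x. 0 \<le> f k x" "\<And>k x. f k x \<le> 1"
        "\<And>x. (\<lambda>k::nat. f k x) \<longlonglongrightarrow> indicator V x"
    for \<rho> :: "(real^'n) set \<Rightarrow> real^'n" and V f i
  proof -
    have "total_variation ?M (\<lambda>B. \<rho> B $ i) (space ?M) < \<infinity>"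
      using total_variation_mono_norm[of ?M "\<lambda>B. \<rho> B $ i" \<rho> \<Omega>] component_le_norm_cart \<rho>(2)
      by (auto simp: space intro: le_less_trans)
    then obtain P N where PN: "finite_measure P" "finite_measure N" "sets P = sets ?M" "sets N = sets ?M"
      "\<And>B. \<rho> B $ i = measure P B - measure N B"
      "\<And>g. signed_integral ?M (\<lambda>B. \<rho> B $ i) g = integral\<^sup>L P g - integral\<^sup>L N g"
      using signed_integral_Jordan[OF vector_measure_bounded_linear[OF \<rho>(1) bounded_linear_vec_nth]] by metis
    have zero: "signed_integral ?M \<sigma> (\<lambda>x. 0) = 0" for \<sigma>
      by (simp add: signed_integral_def)
    have "vector_integral \<Omega> \<rho> (\<lambda>x. g x *\<^sub>R axis i 1) =
        (\<Sum>j\<in>UNIV. if j = i then signed_integral ?M (\<lambda>B. \<rho> B $ i) g else 0)" for g :: "real^'n \<Rightarrow> real"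
      unfolding vector_integral_def by (intro sum.cong) (auto simp: axis_def zero)
    then have "vector_integral \<Omega> \<rho> (\<lambda>x. f k x *\<^sub>R axis i 1) = integral\<^sup>L P (f k) - integral\<^sup>L N (f k)" for k
      by (simp add: PN(6))
    then show ?thesis
      unfolding PN(5)
      by (simp only:) (intro tendsto_diff LIMSEQ_integral_indicator_approx[OF _ _ V f] PN(1-4))
  qed
  have open_eq: "\<mu> V = \<nu> V" if V: "open V" "V \<subseteq> \<Omega>" for V
  proof -
    obtain f :: "nat \<Rightarrow> real^'n \<Rightarrow> real" where f: "\<And>k. f k \<in> Cc_infinity V" "\<And>k x. 0 \<le> f k x" "\<And>k x. f k x \<le> 1"
      "\<And>x. (\<lambda>k. f k x) \<longlonglongrightarrow> indicator V x"
      using smooth_indicator_approx[OF V(1)] by metis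
    have "vector_integral \<Omega> \<mu> (\<lambda>x. f k x *\<^sub>R axis i 1) = vector_integral \<Omega> \<nu> (\<lambda>x. f k x *\<^sub>R axis i 1)" for k i
      by (intro eq Cc_infinity_bounded_linear[OF bounded_linear_scaleR_left] Cc_infinity_mono[OF f(1) V(2)])
    then show ?thesis
      using lim[OF \<mu> V f] lim[OF \<nu> V f] by (simp add: vec_eq_iff) (meson LIMSEQ_unique)
  qed
  show ?thesis
  proof (rule vector_measure_eqI[OF \<mu>(1) \<nu>(1)])
    show "sets ?M = sigma_sets (space ?M) {V. open V \<and> V \<subseteq> \<Omega>}"
      by (simp only: space sets_restrict_borel_open[OF \<Omega>])
    show "Int_stable {V. open V \<and> V \<subseteq> \<Omega>}"
      by (auto simp: Int_stable_def)
  qed (use open_eq \<Omega> in \<open>auto simp: space\<close>)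
qed

section \<open>Assembling the complex-valued identity\<close>

lemma set_integral_complex_of_real_add:
  assumes "set_integrable M \<Omega> p" "set_integrable M \<Omega> q"
  shows "(LINT x:\<Omega>|M. complex_of_real (p x) + \<i> * complex_of_real (q x)) =
    complex_of_real (LINT x:\<Omega>|M. p x) + \<i> * complex_of_real (LINT x:\<Omega>|M. q x)"
proof -
  have *: "set_integrable M \<Omega> (\<lambda>x. complex_of_real (p x))" "set_integrable M \<Omega> (\<lambda>x. complex_of_real (q x))"
    using assms[unfolded set_integrable_def, THEN integrable_of_real[where 'a = complex]]
    by (simp_all add: set_integrable_def scaleR_conv_of_real)
  show ?thesis
    using set_integral_add(2)[OF *(1) set_integrable_mult_right[OF *(2), of \<i>]]
    by (simp add: set_integral_complex_of_real)
qed

theorem lemma3p6: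
  fixes \<Omega> :: "(real^'n::finite) set"
    and A :: "real^'n \<Rightarrow> real^'n"
    and u :: "real^'n \<Rightarrow> complex"
  assumes "open \<Omega>" and "bounded \<Omega>"
    and "A \<in> borel_measurable lebesgue" and "locally_bounded A"
    and "u \<in> BV_A A \<Omega>"
  shows "\<exists>!\<mu> :: (real^'n) set \<Rightarrow> (real^'n) \<times> (real^'n).
    finite_radon_measure \<Omega> \<mu> \<and>
    (\<forall>\<phi>\<in>Cc_infinity \<Omega>.
       (LINT x:\<Omega>|lebesgue. u x * complex_of_real (divergence \<phi> x)
                            + \<i> * complex_of_real (A x \<bullet> \<phi> x) * u x)
       = complex_of_real (LINT x:\<Omega>|lebesgue. Re (u x) * divergence \<phi> x - (A x \<bullet> \<phi> x) * Im (u x))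
         + \<i> * complex_of_real (LINT x:\<Omega>|lebesgue. Im (u x) * divergence \<phi> x + (A x \<bullet> \<phi> x) * Re (u x))
     \<and> complex_of_real (LINT x:\<Omega>|lebesgue. Re (u x) * divergence \<phi> x - (A x \<bullet> \<phi> x) * Im (u x))
         + \<i> * complex_of_real (LINT x:\<Omega>|lebesgue. Im (u x) * divergence \<phi> x + (A x \<bullet> \<phi> x) * Re (u x))
       = complex_vector_integral \<Omega> (\<lambda>B. fst (\<mu> B)) (\<lambda>B. snd (\<mu> B)) \<phi>) \<and>
    magnetic_variation A u \<Omega> =
      enn2ereal (total_variation (restrict_space borel \<Omega>) (\<lambda>B. fst (\<mu> B)) \<Omega>
               + total_variation (restrict_space borel \<Omega>) (\<lambda>B. snd (\<mu> B)) \<Omega>)"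
proof -
  let ?M = "restrict_space borel \<Omega>"
  let ?p = "\<lambda>\<phi> x. Re (u x) * divergence \<phi> x - (A x \<bullet> \<phi> x) * Im (u x)"
  let ?q = "\<lambda>\<phi> x. Im (u x) * divergence \<phi> x + (A x \<bullet> \<phi> x) * Re (u x)"
  have u: "set_integrable lebesgue \<Omega> u" and fin: "C1A A u \<Omega> + C2A A u \<Omega> < \<infinity>"
    using assms(5) by (auto simp: BV_A_def magnetic_variation_def)
  have Re_u: "set_integrable lebesgue \<Omega> (\<lambda>x. Re (u x))" and Im_u: "set_integrable lebesgue \<Omega> (\<lambda>x. Im (u x))"
    using integrable_Re[OF u[unfolded set_integrable_def]] integrable_Im[OF u[unfolded set_integrable_def]]
    by (simp_all add: set_integrable_def)
  then have Im_u': "set_integrable lebesgue \<Omega> (\<lambda>x. - Im (u x))"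
    by (simp add: set_integrable_def)
  have zero: "ereal 0 \<le> (SUP \<phi>\<in>{\<phi> \<in> Cc_infinity \<Omega>. Linfinity_norm \<Omega> \<phi> \<le> 1}. ereal (F \<phi>))"
    if "F (\<lambda>x. 0) = 0" for F :: "(real^'n \<Rightarrow> real^'n) \<Rightarrow> real"
    using that Cc_infinity_zero[of \<Omega>] Linfinity_norm_le_1_iff[OF assms(1) Cc_infinity_zero]
    by (intro SUP_upper2[of "\<lambda>x. 0"]) auto
  have div0: "divergence (\<lambda>x. 0 :: real^'n) x = 0" for x
    using divergence_scaleR[OF C_k_const[of 1 0], of 0] by simp
  \<comment> \<open>The zero field makes both suprema nonnegative, so each is finite as soon as
    their sum is.\<close>
  have "0 \<le> C1A A u \<Omega>" "0 \<le> C2A A u \<Omega>"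
    unfolding C1A_def C2A_def zero_ereal_def by (intro zero; simp add: div0)+
  then have fin1: "C1A A u \<Omega> < \<infinity>" and fin2: "C2A A u \<Omega> < \<infinity>"
    using fin by auto
  have C1: "C1A A u \<Omega> = (SUP \<phi>\<in>{\<phi> \<in> Cc_infinity \<Omega>. Linfinity_norm \<Omega> \<phi> \<le> 1}.
     ereal (LINT x:\<Omega>|lebesgue. Re (u x) * divergence \<phi> x + (A x \<bullet> \<phi> x) * - Im (u x)))"
    by (simp add: C1A_def)
  note r1 = magnetic_functional_representation[OF assms(1-4) Re_u Im_u' fin1[unfolded C1], folded C1]
  note r2 = magnetic_functional_representation[OF assms(1-4) Im_u Re_u fin2[unfolded C2A_def], folded C2A_def]
  obtain \<mu>1 where \<mu>1: "vector_measure ?M \<mu>1" "C1A A u \<Omega> = enn2ereal (total_variation ?M \<mu>1 \<Omega>)"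
    "total_variation ?M \<mu>1 \<Omega> < \<infinity>"
    and \<mu>1_eq: "\<And>\<phi>. \<phi> \<in> Cc_infinity \<Omega> \<Longrightarrow> (LINT x:\<Omega>|lebesgue. ?p \<phi> x) = vector_integral \<Omega> \<mu>1 \<phi>"
    using r1(2) by auto
  obtain \<mu>2 where \<mu>2: "vector_measure ?M \<mu>2" "C2A A u \<Omega> = enn2ereal (total_variation ?M \<mu>2 \<Omega>)"
    "total_variation ?M \<mu>2 \<Omega> < \<infinity>"
    and \<mu>2_eq: "\<And>\<phi>. \<phi> \<in> Cc_infinity \<Omega> \<Longrightarrow> (LINT x:\<Omega>|lebesgue. ?q \<phi> x) = vector_integral \<Omega> \<mu>2 \<phi>"
    using r2(2) by auto
  show ?thesis
  proof (rule ex1I[of _ "\<lambda>B. (\<mu>1 B, \<mu>2 B)"])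
    have vm: "vector_measure ?M (\<lambda>B. (\<mu>1 B, \<mu>2 B))"
    proof -
      have "vector_measure ?M (\<lambda>B. (\<mu>1 B, 0) + (0, \<mu>2 B))"
        by (intro vector_measure_add vector_measure_bounded_linear[OF \<mu>1(1), of "\<lambda>x. (x, 0)"]
            vector_measure_bounded_linear[OF \<mu>2(1), of "\<lambda>x. (0, x)"]
            bounded_linear_Pair bounded_linear_ident bounded_linear_zero)
      then show ?thesis by simp
    qed
    \<comment> \<open>Pairs carry the Euclidean norm of the product, so this is in general not an
      equality. It serves to show finiteness, whereas the mass formula concerns the two components
      separately.\<close>
    have "total_variation ?M (\<lambda>B. (\<mu>1 B, \<mu>2 B)) \<Omega> \<le> total_variation ?M \<mu>1 \<Omega> + total_variation ?M \<mu>2 \<Omega>"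
    proof (rule total_variation_bounded)
      fix E :: "nat \<Rightarrow> _" assume E: "range E \<subseteq> sets ?M" "disjoint_family E" "(\<Union>k. E k) = \<Omega>"
      have "ennreal (norm (\<mu>1 B, \<mu>2 B)) \<le> ennreal (norm (\<mu>1 B)) + ennreal (norm (\<mu>2 B))" for B
        by (simp add: ennreal_leI norm_Pair_le flip: ennreal_plus)
      then have "(\<Sum>k. ennreal (norm (\<mu>1 (E k), \<mu>2 (E k)))) \<le>
          (\<Sum>k. ennreal (norm (\<mu>1 (E k))) + ennreal (norm (\<mu>2 (E k))))"
        by (intro suminf_le) auto
      also have "\<dots> = (\<Sum>k. ennreal (norm (\<mu>1 (E k)))) + (\<Sum>k. ennreal (norm (\<mu>2 (E k))))"
        by (simp add: suminf_add[symmetric])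
      also have "\<dots> \<le> total_variation ?M \<mu>1 \<Omega> + total_variation ?M \<mu>2 \<Omega>"
        by (intro add_mono suminf_le_total_variation E)
      finally show "(\<Sum>k. ennreal (norm (\<mu>1 (E k), \<mu>2 (E k)))) \<le> total_variation ?M \<mu>1 \<Omega> + total_variation ?M \<mu>2 \<Omega>" .
    qed
    then have radon: "finite_radon_measure \<Omega> (\<lambda>B. (\<mu>1 B, \<mu>2 B))"
      using vm \<mu>1(3) \<mu>2(3) by (auto simp: finite_radon_measure_def intro: le_less_trans)
    have complex: "(LINT x:\<Omega>|lebesgue. u x * complex_of_real (divergence \<phi> x) + \<i> * complex_of_real (A x \<bullet> \<phi> x) * u x)
       = complex_of_real (LINT x:\<Omega>|lebesgue. ?p \<phi> x) + \<i> * complex_of_real (LINT x:\<Omega>|lebesgue. ?q \<phi> x)"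
      if "\<phi> \<in> Cc_infinity \<Omega>" for \<phi>
    proof -
      have "u x * complex_of_real (divergence \<phi> x) + \<i> * complex_of_real (A x \<bullet> \<phi> x) * u x
          = complex_of_real (?p \<phi> x) + \<i> * complex_of_real (?q \<phi> x)" for x
        by (simp add: complex_eq_iff algebra_simps)
      moreover have "set_integrable lebesgue \<Omega> (?p \<phi>)" "set_integrable lebesgue \<Omega> (?q \<phi>)"
        using r1(1)[OF that] r2(1)[OF that] by simp_all
      ultimately show ?thesis
        by (simp only: set_integral_complex_of_real_add)
    qed
    have "magnetic_variation A u \<Omega> = enn2ereal (total_variation ?M \<mu>1 \<Omega> + total_variation ?M \<mu>2 \<Omega>)"
      by (simp add: magnetic_variation_def \<mu>1(2) \<mu>2(2) plus_ennreal.rep_eq)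
    with radon complex show "finite_radon_measure \<Omega> (\<lambda>B. (\<mu>1 B, \<mu>2 B)) \<and>
      (\<forall>\<phi>\<in>Cc_infinity \<Omega>.
        (LINT x:\<Omega>|lebesgue. u x * complex_of_real (divergence \<phi> x) + \<i> * complex_of_real (A x \<bullet> \<phi> x) * u x)
          = complex_of_real (LINT x:\<Omega>|lebesgue. ?p \<phi> x) + \<i> * complex_of_real (LINT x:\<Omega>|lebesgue. ?q \<phi> x)
        \<and> complex_of_real (LINT x:\<Omega>|lebesgue. ?p \<phi> x) + \<i> * complex_of_real (LINT x:\<Omega>|lebesgue. ?q \<phi> x)
          = complex_vector_integral \<Omega> (\<lambda>B. fst (\<mu>1 B, \<mu>2 B)) (\<lambda>B. snd (\<mu>1 B, \<mu>2 B)) \<phi>) \<and>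
      magnetic_variation A u \<Omega> = enn2ereal (total_variation ?M (\<lambda>B. fst (\<mu>1 B, \<mu>2 B)) \<Omega>
        + total_variation ?M (\<lambda>B. snd (\<mu>1 B, \<mu>2 B)) \<Omega>)"
      by (simp add: complex_vector_integral_def \<mu>1_eq \<mu>2_eq)
  next
    fix \<nu> :: "(real^'n) set \<Rightarrow> (real^'n) \<times> (real^'n)"
    assume "finite_radon_measure \<Omega> \<nu> \<and>
      (\<forall>\<phi>\<in>Cc_infinity \<Omega>.
        (LINT x:\<Omega>|lebesgue. u x * complex_of_real (divergence \<phi> x) + \<i> * complex_of_real (A x \<bullet> \<phi> x) * u x)
          = complex_of_real (LINT x:\<Omega>|lebesgue. ?p \<phi> x) + \<i> * complex_of_real (LINT x:\<Omega>|lebesgue. ?q \<phi> x)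
        \<and> complex_of_real (LINT x:\<Omega>|lebesgue. ?p \<phi> x) + \<i> * complex_of_real (LINT x:\<Omega>|lebesgue. ?q \<phi> x)
          = complex_vector_integral \<Omega> (\<lambda>B. fst (\<nu> B)) (\<lambda>B. snd (\<nu> B)) \<phi>) \<and>
      magnetic_variation A u \<Omega> = enn2ereal (total_variation ?M (\<lambda>B. fst (\<nu> B)) \<Omega>
        + total_variation ?M (\<lambda>B. snd (\<nu> B)) \<Omega>)"
    then have \<nu>: "vector_measure ?M \<nu>" "total_variation ?M \<nu> \<Omega> < \<infinity>"
      and \<nu>_eq: "\<And>\<phi>. \<phi> \<in> Cc_infinity \<Omega> \<Longrightarrow>
        complex_of_real (LINT x:\<Omega>|lebesgue. ?p \<phi> x) + \<i> * complex_of_real (LINT x:\<Omega>|lebesgue. ?q \<phi> x)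
          = complex_vector_integral \<Omega> (\<lambda>B. fst (\<nu> B)) (\<lambda>B. snd (\<nu> B)) \<phi>"
      by (auto simp: finite_radon_measure_def)
    \<comment> \<open>Both sides are complex numbers built from real integrals, so comparing real
      and imaginary parts separates the two components.\<close>
    have eq: "vector_integral \<Omega> \<mu>1 \<phi> = vector_integral \<Omega> (\<lambda>B. fst (\<nu> B)) \<phi>"
      "vector_integral \<Omega> \<mu>2 \<phi> = vector_integral \<Omega> (\<lambda>B. snd (\<nu> B)) \<phi>" if "\<phi> \<in> Cc_infinity \<Omega>" for \<phi>
      using \<nu>_eq[OF that] unfolding \<mu>1_eq[OF that] \<mu>2_eq[OF that] complex_vector_integral_def
      by (simp_all add: complex_eq_iff)
    have fst: "\<mu>1 = (\<lambda>B. fst (\<nu> B))"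
    proof (rule vector_measure_unique[OF assms(1) \<mu>1(1,3) vector_measure_bounded_linear[OF \<nu>(1) bounded_linear_fst] _ eq(1)])
      show "total_variation ?M (\<lambda>B. fst (\<nu> B)) \<Omega> < \<infinity>"
        by (rule le_less_trans[OF total_variation_mono_norm[of ?M "\<lambda>B. fst (\<nu> B)" \<nu>] \<nu>(2)])
          (metis norm_fst_le prod.collapse)
    qed
    have snd: "\<mu>2 = (\<lambda>B. snd (\<nu> B))"
    proof (rule vector_measure_unique[OF assms(1) \<mu>2(1,3) vector_measure_bounded_linear[OF \<nu>(1) bounded_linear_snd] _ eq(2)])
      show "total_variation ?M (\<lambda>B. snd (\<nu> B)) \<Omega> < \<infinity>"
        by (rule le_less_trans[OF total_variation_mono_norm[of ?M "\<lambda>B. snd (\<nu> B)" \<nu>] \<nu>(2)])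
          (metis norm_snd_le prod.collapse)
    qed
    show "\<nu> = (\<lambda>B. (\<mu>1 B, \<mu>2 B))"
      by (simp add: fst snd)
  qed
qed

end
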